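(* Define $\mathsf{A}:=(A_1,A_2)$ where \[A_1:=\begin{pmatrix}0&2\\1&0\end{pmatrix},\qquad A_2:=\begin{pmatrix}0&1\\2&0\end{pmatrix}.\] Then for every $s>0$, the unique equilibrium state $\mu$ of $(\mathsf{A},s)$ is not ergodic with respect to $\sigma^2$. In particular it is not mixing with respect to $\sigma$.
   Context: $\Sigma_2:=\{1,2\}^{\mathbb{N}}$ with the product topology; $\sigma$ is the shift $\sigma[(x_n)_{n=1}^\infty]=(x_{n+1})_{n=1}^\infty$; $\mathcal{M}_\sigma$ is the set of $\sigma$-invariant Borel probability measures on $\Sigma_2$; $h(\nu)$ is the metric entropy of $\nu\in\mathcal{M}_\sigma$ with respect to $\sigma$; $\|\cdot\|$ is the operator norm on real $2\times2$ matrices induced by the Euclidean norm. The top Lyapunov exponent is $\Lambda(\mathsf{A},\nu):=\lim_{n\to\infty}\frac1n\int_{\Sigma_2}\log\|A_{x_n}\cdots A_{x_1}\|\,d\nu(x)$. An equilibrium state of $(\mathsf{A},s)$ is a measure $\mu\in\mathcal{M}_\sigma$ attaining $\sup_{\nu\in\mathcal{M}_\sigma}\bigl(h(\nu)+s\Lambda(\mathsf{A},\nu)\bigr)$. It is known (Feng–Käenmäki) that the equilibrium state is unique whenever $\mathsf{A}$ is an irreducible tuple of $d\times d$ matrices with $d\geq2$, irreducible meaning that no linear subspace $U$ with $0<\dim U<d$ satisfies $A_iU\subseteq U$ for all $i$. *)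

theory Defs
  imports "HOL-Probability.Probability"
begin

text \<open>
  Sequences are indexed from 0, so the coordinate written \<open>x\<^sub>n\<close> with \<open>n \<ge> 1\<close> is \<open>x (n - 1)\<close> here.
\<close>

definition Sigma2_top :: "(nat \<Rightarrow> nat) topology" where
  "Sigma2_top = product_topology (\<lambda>_. discrete_topology {1, 2}) UNIV"

definition Sigma2 :: "(nat \<Rightarrow> nat) measure" where
  "Sigma2 = sigma (topspace Sigma2_top) {U. openin Sigma2_top U}"

definition left_shift :: "(nat \<Rightarrow> 'b) \<Rightarrow> nat \<Rightarrow> 'b" where
  "left_shift x = (\<lambda>n. x (Suc n))"

definition invariant_measures :: "(nat \<Rightarrow> nat) measure set" where
  "invariant_measures =
     {\<nu>. prob_space \<nu> \<and> sets \<nu> = sets Sigma2 \<and>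
          (\<forall>B\<in>sets \<nu>. emeasure \<nu> (left_shift -` B \<inter> space \<nu>) = emeasure \<nu> B)}"

definition finite_partition :: "'a measure \<Rightarrow> 'a set set \<Rightarrow> bool" where
  "finite_partition M P \<longleftrightarrow> finite P \<and> P \<subseteq> sets M \<and> disjoint P \<and> \<Union>P = space M"

text \<open>The convention \<open>0 log 0 = 0\<close> is automatic because of the factor in front of \<open>ln\<close>.\<close>

definition partition_entropy :: "'a measure \<Rightarrow> 'a set set \<Rightarrow> real" where
  "partition_entropy M P = - (\<Sum>B\<in>P. measure M B * ln (measure M B))"

text \<open>
  The common refinement of \<open>T\<^sup>-\<^sup>i P\<close> for \<open>i < n\<close>. It may contain the empty set, which does not
  contribute to the entropy.
\<close>

primrec refinement :: "'a measure \<Rightarrow> ('a \<Rightarrow> 'a) \<Rightarrow> 'a set set \<Rightarrow> nat \<Rightarrow> 'a set set" where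
  "refinement M T P 0 = {space M}"
| "refinement M T P (Suc n) =
     {B \<inter> ((T ^^ n) -` C \<inter> space M) | B C. B \<in> refinement M T P n \<and> C \<in> P}"

text \<open>For measure-preserving \<open>T\<close> the limit exists by subadditivity.\<close>

definition entropy_wrt :: "'a measure \<Rightarrow> ('a \<Rightarrow> 'a) \<Rightarrow> 'a set set \<Rightarrow> real" where
  "entropy_wrt M T P = lim (\<lambda>n. partition_entropy M (refinement M T P n) / real n)"

definition metric_entropy :: "'a measure \<Rightarrow> ('a \<Rightarrow> 'a) \<Rightarrow> ereal" where
  "metric_entropy M T = (SUP P\<in>{P. finite_partition M P}. ereal (entropy_wrt M T P))"

primrec cocycle :: "(nat \<Rightarrow> real^2^2) \<Rightarrow> (nat \<Rightarrow> nat) \<Rightarrow> nat \<Rightarrow> real^2^2" where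
  "cocycle A x 0 = mat 1"
| "cocycle A x (Suc n) = A (x n) ** cocycle A x n"

text \<open>
  This is the intended quantity only for tuples of invertible matrices: for those \<open>ln\<close> is never
  taken at 0 and the limit exists in the reals by subadditivity. In general the value could be
  \<open>-\<infinity>\<close>.
\<close>

definition lyapunov :: "(nat \<Rightarrow> real^2^2) \<Rightarrow> (nat \<Rightarrow> nat) measure \<Rightarrow> real" where
  "lyapunov A \<nu> = lim (\<lambda>n. (1 / real n) * (LINT x|\<nu>. ln (onorm ((*v) (cocycle A x n)))))"

definition equilibrium_state :: "(nat \<Rightarrow> real^2^2) \<Rightarrow> real \<Rightarrow> (nat \<Rightarrow> nat) measure \<Rightarrow> bool" where
  "equilibrium_state A s \<mu> \<longleftrightarrow>
     \<mu> \<in> invariant_measures \<and>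
     metric_entropy \<mu> left_shift + ereal (s * lyapunov A \<mu>) =
       (SUP \<nu>\<in>invariant_measures. metric_entropy \<nu> left_shift + ereal (s * lyapunov A \<nu>))"

text \<open>
  The next two predicates are meant for probability measures \<open>M\<close> that are already known to be
  \<open>T\<close>-invariant. Invariance is not a conjunct, so their negations cannot hold merely for lack of it.
\<close>

definition is_ergodic :: "'a measure \<Rightarrow> ('a \<Rightarrow> 'a) \<Rightarrow> bool" where
  "is_ergodic M T \<longleftrightarrow>
     (\<forall>B\<in>sets M. T -` B \<inter> space M = B \<longrightarrow> measure M B = 0 \<or> measure M B = 1)"

definition is_mixing :: "'a measure \<Rightarrow> ('a \<Rightarrow> 'a) \<Rightarrow> bool" where
  "is_mixing M T \<longleftrightarrow>
     (\<forall>B\<in>sets M. \<forall>C\<in>sets M.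
        (\<lambda>n. measure M (B \<inter> ((T ^^ n) -` C \<inter> space M))) \<longlonglongrightarrow> measure M B * measure M C)"

text \<open>Matrices are given by their rows. Only the indices 1 and 2 are relevant.\<close>

definition AA :: "nat \<Rightarrow> real^2^2" where
  "AA i = (if i = 1 then vector [vector [0, 2], vector [1, 0]]
           else vector [vector [0, 1], vector [2, 0]])"

end

theory Submission
  imports Defs
begin

text \<open>
  Both matrices exchange the two coordinate axes, so the product of length \<open>n\<close> along a sequence \<open>x\<close>
  is a diagonal or antidiagonal matrix. Its two entries are \<open>2\<^sup>a\<close> and \<open>2\<^sup>n\<^sup>-\<^sup>a\<close>, where \<open>a = gain x n\<close>
  counts the steps that stretch the image of the first axis, and its norm is the larger of the two.
  Put \<open>r = 2\<^sup>s\<close>. Up to a factor between 1 and 2, the \<open>s\<close>-th power of the norm is then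
  \<open>r\<^sup>a + r\<^sup>n\<^sup>-\<^sup>a\<close>. Whether a step stretches the first axis depends only on the symbol and on the parity of
  the position, so \<open>r\<^sup>a / (1 + r)\<^sup>n\<close> is the measure of the word under the product measure whose symbol
  probabilities \<open>r / (1 + r)\<close> and \<open>1 / (1 + r)\<close> swap roles at every position; \<open>r\<^sup>n\<^sup>-\<^sup>a / (1 + r)\<^sup>n\<close>
  belongs to the same product measure with the opposite phase. The average of the two product
  measures (\<open>mixture\<close>) is shift invariant, and it is a Gibbs measure: its cylinder measures are the
  \<open>s\<close>-th powers of the norms divided by \<open>(1 + r)\<^sup>n\<close>, up to a bounded factor. It is the equilibrium
  state. The two phases are distinct \<open>\<sigma>\<^sup>2\<close>-invariant measures, exchanged by \<open>\<sigma>\<close> and separated by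
  the asymptotic frequency of stretching steps, so the average is not ergodic for \<open>\<sigma>\<^sup>2\<close>; a mixing map
  would have only ergodic powers.

  The variational part rests on one inequality, \<open>gibbs_inequality\<close>: the entropy of a finite-valued
  random variable is at most its cross entropy with respect to any subprobability vector. Applied to
  the cylinder measures of the mixture it gives \<open>h(\<nu>) + s \<Lambda>(\<nu>) \<le> ln (1 + r)\<close>. For the uniqueness the
  weights are increased on a set of words that is small for the mixture (\<open>gibbs_deficit\<close>). If \<open>\<nu>\<close>
  attains the bound, then events depending on finitely many coordinates have small \<open>\<nu>\<close>-measure as soon
  as they have small measure for the mixture, uniformly in the number of coordinates. A second moment
  estimate shows that under the mixture the frequency of any fixed word is close to a constant
  outside a set of small measure. The same then holds under \<open>\<nu>\<close>, and by invariance the two measures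
  agree on all cylinders (\<open>equality_case\<close>). This avoids the ergodic theorem.

  Metric entropy is a supremum over all finite partitions. The reduction to the partition by the first
  symbol (\<open>metric_entropy_generator\<close>, the Kolmogorov-Sinai theorem) is again deduced from
  \<open>gibbs_inequality\<close>, with Markov kernels as weights.
\<close>

section \<open>Entropy of finite-valued random variables\<close>

definition mass :: "'a measure \<Rightarrow> ('a \<Rightarrow> 'b) \<Rightarrow> 'b \<Rightarrow> real" where
  "mass M X v = measure M (X -` {v} \<inter> space M)"

text \<open>
  The Shannon entropy of a random variable with finitely many values, as the mean of the information
  function. In this form invariance under a measure-preserving map is a change of variables. Values of mass
  zero are harmless, since they are taken on a null set only.
\<close>
definition label_entropy :: "'a measure \<Rightarrow> ('a \<Rightarrow> 'b) \<Rightarrow> real" where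
  "label_entropy M X = (LINT \<omega>|M. - ln (mass M X (X \<omega>)))"

lemma mass_nonneg [simp]: "0 \<le> mass M X v"
  by (simp add: mass_def)

context prob_space
begin

lemma
  fixes g :: "'b \<Rightarrow> real"
  assumes X: "simple_function M X"
  shows integrable_label: "integrable M (\<lambda>\<omega>. g (X \<omega>))"
    and integral_label: "(LINT \<omega>|M. g (X \<omega>)) = (\<Sum>v\<in>X ` space M. g v * mass M X v)"
proof -
  have sf: "simple_function M (\<lambda>\<omega>. g (X \<omega>))"
    using simple_function_compose1[OF X] by blast
  have sb: "Bochner_Integration.simple_bochner_integrable M (\<lambda>\<omega>. g (X \<omega>))"
  proof
    show "emeasure M {y \<in> space M. g (X y) \<noteq> 0} \<noteq> \<infinity>" by simp
  qed (rule sf)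
  show "integrable M (\<lambda>\<omega>. g (X \<omega>))"
    using sb by (rule integrableI_simple_bochner_integrable)
  have "(LINT \<omega>|M. g (X \<omega>)) = Bochner_Integration.simple_bochner_integral M (\<lambda>\<omega>. g (X \<omega>))"
    using simple_bochner_integrable_eq_integral[OF sb] by simp
  also have "\<dots> = (\<Sum>v\<in>X ` space M. measure M {x\<in>space M. X x = v} *\<^sub>R g v)"
    by (rule simple_bochner_integral_partition[OF sb X]) auto
  also have "\<dots> = (\<Sum>v\<in>X ` space M. g v * mass M X v)"
    by (intro sum.cong refl) (auto simp: mass_def vimage_def Int_def conj_commute)
  finally show "(LINT \<omega>|M. g (X \<omega>)) = (\<Sum>v\<in>X ` space M. g v * mass M X v)" .
qed

lemma sum_mass:
  assumes X: "simple_function M X"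
  shows "(\<Sum>v\<in>X ` space M. mass M X v) = 1"
  using integral_label[OF X, of "\<lambda>_. 1"] by (simp add: prob_space)

lemma integral_label_mono:
  fixes f g :: "'b \<Rightarrow> real"
  assumes X: "simple_function M X"
    and le: "\<And>v. v \<in> X ` space M \<Longrightarrow> 0 < mass M X v \<Longrightarrow> f v \<le> g v"
  shows "(LINT \<omega>|M. f (X \<omega>)) \<le> (LINT \<omega>|M. g (X \<omega>))"
  unfolding integral_label[OF X]
proof (rule sum_mono)
  fix v assume "v \<in> X ` space M"
  then show "f v * mass M X v \<le> g v * mass M X v"
    using le[of v] mass_nonneg[of M X v] by (cases "mass M X v = 0") (auto intro: mult_right_mono)
qed

lemma label_entropy_sum:
  assumes X: "simple_function M X"
  shows "label_entropy M X = (\<Sum>v\<in>X ` space M. - ln (mass M X v) * mass M X v)"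
  unfolding label_entropy_def by (rule integral_label[OF X])

text \<open>
  Nonnegativity of relative entropy, by \<open>ln t \<le> t - 1\<close> applied to the ratios of weights to masses.
  Every upper bound for an entropy below comes from a choice of the weights \<open>m\<close>.
\<close>
lemma gibbs_inequality:
  fixes m :: "'b \<Rightarrow> real"
  assumes X: "simple_function M X"
    and nonneg: "\<And>v. v \<in> X ` space M \<Longrightarrow> 0 \<le> m v"
    and pos: "\<And>v. v \<in> X ` space M \<Longrightarrow> 0 < mass M X v \<Longrightarrow> 0 < m v"
    and sub: "(\<Sum>v\<in>X ` space M. m v) \<le> 1"
  shows "label_entropy M X \<le> (LINT \<omega>|M. - ln (m (X \<omega>)))"
proof -
  have "label_entropy M X - (LINT \<omega>|M. - ln (m (X \<omega>)))
      = (\<Sum>v\<in>X ` space M. (ln (m v) - ln (mass M X v)) * mass M X v)"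
    unfolding label_entropy_sum[OF X] integral_label[OF X, of "\<lambda>v. - ln (m v)"] sum_subtractf[symmetric]
    by (intro sum.cong) (auto simp: algebra_simps)
  also have "\<dots> \<le> (\<Sum>v\<in>X ` space M. m v - mass M X v)"
  proof (rule sum_mono)
    fix v assume v: "v \<in> X ` space M"
    show "(ln (m v) - ln (mass M X v)) * mass M X v \<le> m v - mass M X v"
    proof (cases "mass M X v = 0")
      case True
      then show ?thesis using nonneg[OF v] by simp
    next
      case False
      then have p: "0 < mass M X v" using mass_nonneg[of M X v] by linarith
      have "ln (m v) - ln (mass M X v) = ln (m v / mass M X v)"
        using pos[OF v p] p by (simp add: ln_div)
      also have "\<dots> \<le> m v / mass M X v - 1"
        using pos[OF v p] p by (intro ln_le_minus_one) auto
      finally have "(ln (m v) - ln (mass M X v)) * mass M X v \<le> (m v / mass M X v - 1) * mass M X v"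
        using p by (intro mult_right_mono) auto
      also have "\<dots> = m v - mass M X v"
        using p by (simp add: field_simps)
      finally show ?thesis .
    qed
  qed
  also have "\<dots> \<le> 0"
    using sub sum_mass[OF X] by (simp add: sum_subtractf)
  finally show ?thesis by simp
qed

lemma mass_compose_ge:
  assumes Z: "simple_function M Z"
  shows "mass M Z v \<le> mass M (\<lambda>\<omega>. f (Z \<omega>)) (f v)"
  unfolding mass_def
  using simple_functionD(2)[OF simple_function_compose1[OF Z, of f]]
  by (intro finite_measure_mono) (auto simp: comp_def)

lemma label_entropy_compose_le:
  assumes Z: "simple_function M Z"
  shows "label_entropy M (\<lambda>\<omega>. f (Z \<omega>)) \<le> label_entropy M Z"
  unfolding label_entropy_def
proof (rule integral_label_mono[OF Z])
  fix v assume "0 < mass M Z v"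
  then show "- ln (mass M (\<lambda>\<omega>. f (Z \<omega>)) (f v)) \<le> - ln (mass M Z v)"
    using mass_compose_ge[OF Z, of v f] by simp
qed

lemma label_entropy_nonneg:
  assumes X: "simple_function M X"
  shows "0 \<le> label_entropy M X"
  unfolding label_entropy_def 
proof (intro integral_nonneg_AE AE_I2)
  fix \<omega>
  show "0 \<le> - ln (mass M X (X \<omega>))"
    by (cases "mass M X (X \<omega>) = 0") (auto simp: mass_def zero_less_measure_iff)
qed

text \<open>
  The chain rule with the true conditional distribution of \<open>W\<close> given \<open>V\<close> replaced by an arbitrary
  kernel: the weights are the law of \<open>V\<close> times the kernel. The true kernel conditioned on less
  information and a noisy guess are the two cases of interest.
\<close>
lemma label_entropy_kernel:
  fixes \<kappa> :: "'b \<Rightarrow> 'c \<Rightarrow> real"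
  assumes V: "simple_function M V" and W: "simple_function M W"
    and nonneg: "\<And>v w. 0 \<le> \<kappa> v w"
    and pos: "\<And>v w. 0 < mass M (\<lambda>\<omega>. (V \<omega>, W \<omega>)) (v, w) \<Longrightarrow> 0 < \<kappa> v w"
    and sub: "\<And>v. v \<in> V ` space M \<Longrightarrow> (\<Sum>w\<in>W ` space M. \<kappa> v w) \<le> 1"
  shows "label_entropy M (\<lambda>\<omega>. (V \<omega>, W \<omega>))
    \<le> label_entropy M V + (LINT \<omega>|M. - ln (\<kappa> (V \<omega>) (W \<omega>)))"
proof -
  let ?VW = "\<lambda>\<omega>. (V \<omega>, W \<omega>)"
  define m where "m = (\<lambda>(v, w). mass M V v * \<kappa> v w)"
  have VW: "simple_function M ?VW" using V W by simp
  have fin: "finite (V ` space M)" "finite (W ` space M)"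
    using V W by (auto dest: simple_functionD)
  have posV: "0 < mass M V v" if "0 < mass M ?VW (v, w)" for v w
    using mass_compose_ge[OF VW, of "(v, w)" fst] that by simp
  have m_pos: "0 < m vw" if "0 < mass M ?VW vw" for vw
    using that posV pos by (cases vw) (auto simp: m_def intro!: mult_pos_pos)
  have "(\<Sum>vw\<in>?VW ` space M. m vw) \<le> (\<Sum>vw\<in>V ` space M \<times> W ` space M. m vw)"
    using fin nonneg by (intro sum_mono2) (auto simp: m_def)
  also have "\<dots> = (\<Sum>v\<in>V ` space M. mass M V v * (\<Sum>w\<in>W ` space M. \<kappa> v w))"
    by (simp add: m_def sum.cartesian_product[symmetric] sum_distrib_left)
  also have "\<dots> \<le> (\<Sum>v\<in>V ` space M. mass M V v * 1)"
    using sub by (intro sum_mono mult_left_mono) auto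
  finally have m_sub: "(\<Sum>vw\<in>?VW ` space M. m vw) \<le> 1"
    using sum_mass[OF V] by simp
  have "label_entropy M ?VW \<le> (LINT \<omega>|M. - ln (m (?VW \<omega>)))"
    by (rule gibbs_inequality[OF VW _ m_pos m_sub]) (use nonneg in \<open>auto simp: m_def\<close>)
  also have "\<dots> \<le> (LINT \<omega>|M. (\<lambda>(v, w). - ln (mass M V v) - ln (\<kappa> v w)) (?VW \<omega>))"
  proof (rule integral_label_mono[OF VW])
    fix vw assume vw: "0 < mass M ?VW vw"
    obtain v w where [simp]: "vw = (v, w)" by force
    show "- ln (m vw) \<le> (\<lambda>(v, w). - ln (mass M V v) - ln (\<kappa> v w)) vw"
      using vw posV[of v w] pos[of v w] by (simp add: m_def ln_mult)
  qed
  also have "\<dots> = (LINT \<omega>|M. - ln (mass M V (V \<omega>)) + - ln (\<kappa> (V \<omega>) (W \<omega>)))"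
    by simp
  also have "\<dots> = label_entropy M V + (LINT \<omega>|M. - ln (\<kappa> (V \<omega>) (W \<omega>)))"
    unfolding label_entropy_def
    using integrable_label[OF V, of "\<lambda>v. - ln (mass M V v)"]
      integrable_label[OF VW, of "\<lambda>(v, w). - ln (\<kappa> v w)"]
    by (intro Bochner_Integration.integral_add) auto
  finally show ?thesis .
qed

lemma sum_mass_Pair:
  assumes V: "simple_function M V" and W: "simple_function M W"
  shows "(\<Sum>w\<in>W ` space M. mass M (\<lambda>\<omega>. (V \<omega>, W \<omega>)) (v, w)) = mass M V v"
proof -
  have eq: "(\<lambda>\<omega>. (V \<omega>, W \<omega>)) -` {(v, w)} \<inter> space M = (V -` {v} \<inter> space M) \<inter> (W -` {w} \<inter> space M)" for w
    by auto
  have "mass M V v = measure M (\<Union>w\<in>W ` space M. (V -` {v} \<inter> space M) \<inter> (W -` {w} \<inter> space M))"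
    unfolding mass_def by (rule arg_cong[where f="measure M"]) auto
  also have "\<dots> = (\<Sum>w\<in>W ` space M. measure M ((V -` {v} \<inter> space M) \<inter> (W -` {w} \<inter> space M)))"
    using simple_functionD[OF V] simple_functionD[OF W]
    by (intro finite_measure_finite_Union) (auto simp: disjoint_family_on_def)
  finally show ?thesis unfolding mass_def eq by simp
qed

text \<open>
  The new information in \<open>W\<close> can only grow when less than \<open>Z\<close> is remembered. The kernel is the
  conditional distribution of \<open>W\<close> given \<open>g (Z \<omega>)\<close>.
\<close>
lemma label_entropy_Pair_le:
  assumes Z: "simple_function M Z" and W: "simple_function M W"
  shows "label_entropy M (\<lambda>\<omega>. (Z \<omega>, W \<omega>))
    \<le> label_entropy M Z + (label_entropy M (\<lambda>\<omega>. (g (Z \<omega>), W \<omega>)) - label_entropy M (\<lambda>\<omega>. g (Z \<omega>)))"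
proof -
  let ?V = "\<lambda>\<omega>. g (Z \<omega>)"
  let ?VW = "\<lambda>\<omega>. (g (Z \<omega>), W \<omega>)"
  have V: "simple_function M ?V" using simple_function_compose1[OF Z] .
  have VW: "simple_function M ?VW" using V W by simp
  have ZW: "simple_function M (\<lambda>\<omega>. (Z \<omega>, W \<omega>))" using Z W by simp
  define \<kappa> where "\<kappa> z w = mass M ?VW (g z, w) / mass M ?V (g z)" for z w
  have pos: "0 < mass M ?V v" if "0 < mass M ?VW (v, w)" for v w
    using mass_compose_ge[OF VW, of "(v, w)" fst] that by simp
  have "label_entropy M (\<lambda>\<omega>. (Z \<omega>, W \<omega>)) \<le> label_entropy M Z + (LINT \<omega>|M. - ln (\<kappa> (Z \<omega>) (W \<omega>)))"
  proof (rule label_entropy_kernel[OF Z W])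
    fix z w assume "0 < mass M (\<lambda>\<omega>. (Z \<omega>, W \<omega>)) (z, w)"
    moreover have "mass M (\<lambda>\<omega>. (Z \<omega>, W \<omega>)) (z, w) \<le> mass M ?VW (g z, w)"
      using mass_compose_ge[OF ZW, of "(z, w)" "\<lambda>(z, w). (g z, w)"] by simp
    ultimately have "0 < mass M ?VW (g z, w)" by simp
    then show "0 < \<kappa> z w" using pos by (simp add: \<kappa>_def)
  next
    fix z
    have "(\<Sum>w\<in>W ` space M. \<kappa> z w) = mass M ?V (g z) / mass M ?V (g z)"
      unfolding \<kappa>_def sum_divide_distrib[symmetric] sum_mass_Pair[OF V W] ..
    then show "(\<Sum>w\<in>W ` space M. \<kappa> z w) \<le> 1" by simp
  qed (simp add: \<kappa>_def)
  also have "(LINT \<omega>|M. - ln (\<kappa> (Z \<omega>) (W \<omega>)))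
      \<le> (LINT \<omega>|M. (\<lambda>(v, w). - ln (mass M ?VW (v, w)) + ln (mass M ?V v)) (?VW \<omega>))"
 (is "?l \<le> ?r")
  proof -
    have "?l = (LINT \<omega>|M. (\<lambda>(v, w). - ln (mass M ?VW (v, w) / mass M ?V v)) (?VW \<omega>))"
      by (simp add: \<kappa>_def)
    also have "\<dots> \<le> ?r"
    proof (rule integral_label_mono[OF VW])
      fix vw assume vw: "0 < mass M ?VW vw"
      obtain v w where [simp]: "vw = (v, w)" by force
      show "(case vw of (v, w) \<Rightarrow> - ln (mass M ?VW (v, w) / mass M ?V v))
          \<le> (case vw of (v, w) \<Rightarrow> - ln (mass M ?VW (v, w)) + ln (mass M ?V v))"
        using vw pos[of v w] by (simp add: ln_div)
    qed
    finally show ?thesis .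
  qed
  also have "\<dots> = (LINT \<omega>|M. - ln (mass M ?VW (?VW \<omega>)) - - ln (mass M ?V (?V \<omega>)))"
    by simp
  also have "\<dots> = label_entropy M ?VW - label_entropy M ?V"
    unfolding label_entropy_def
    using integrable_label[OF V, of "\<lambda>v. - ln (mass M ?V v)"]
      integrable_label[OF VW, of "\<lambda>v. - ln (mass M ?VW v)"]
    by (intro Bochner_Integration.integral_diff) auto
  finally show ?thesis by simp
qed

lemma label_entropy_Pair_le_add:
  assumes Z: "simple_function M Z" and W: "simple_function M W"
  shows "label_entropy M (\<lambda>\<omega>. (Z \<omega>, W \<omega>)) \<le> label_entropy M Z + label_entropy M W"
proof -
  have "label_entropy M (\<lambda>\<omega>. ((), W \<omega>)) \<le> label_entropy M W"
    using label_entropy_compose_le[OF W, of "\<lambda>w. ((), w)"] .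
  then show ?thesis
    using label_entropy_Pair_le[OF Z W, of "\<lambda>_. ()"] label_entropy_nonneg[of "\<lambda>_. ()"] by simp
qed

text \<open>
  If \<open>W\<close> is determined by \<open>V\<close> with high probability, it carries little additional entropy. The
  kernel bets \<open>1 - \<delta>\<close> on the guess and spreads \<open>\<delta>\<close> evenly over all values, so that a wrong guess costs
  at most \<open>ln (l / \<delta>)\<close>, where \<open>l\<close> is the number of values.
\<close>
lemma fano_inequality:
  assumes V: "simple_function M V" and W: "simple_function M W" and \<delta>: "0 < \<delta>" "\<delta> < 1"
  shows "label_entropy M (\<lambda>\<omega>. (V \<omega>, W \<omega>)) - label_entropy M V
    \<le> - ln (1 - \<delta>) + prob {\<omega>\<in>space M. W \<omega> \<noteq> u (V \<omega>)} * ln (real (card (W ` space M)) / \<delta>)"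
proof -
  define l where "l = real (card (W ` space M))"
  define \<kappa> where "\<kappa> v w = (1 - \<delta>) * of_bool (w = u v) + \<delta> / l" for v w
  have fin: "finite (W ` space M)" using W by (rule simple_functionD)
  have l: "1 \<le> l"
    using fin not_empty by (auto simp: l_def Suc_le_eq card_gt_0_iff)
  let ?E = "{\<omega>\<in>space M. W \<omega> \<noteq> u (V \<omega>)}"
  have VW: "simple_function M (\<lambda>\<omega>. (V \<omega>, W \<omega>))" using V W by simp
  have E: "?E \<in> events"
  proof -
    have "(\<lambda>\<omega>. (V \<omega>, W \<omega>)) \<in> measurable M (count_space UNIV)"
      using VW by (rule measurable_simple_function)
    then have "(\<lambda>\<omega>. (V \<omega>, W \<omega>)) -` {(v, w). w \<noteq> u v} \<inter> space M \<in> events"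
      by (rule measurable_sets) simp
    moreover have "(\<lambda>\<omega>. (V \<omega>, W \<omega>)) -` {(v, w). w \<noteq> u v} \<inter> space M = ?E" by auto
    ultimately show ?thesis by simp
  qed
  have "label_entropy M (\<lambda>\<omega>. (V \<omega>, W \<omega>)) \<le> label_entropy M V + (LINT \<omega>|M. - ln (\<kappa> (V \<omega>) (W \<omega>)))"
  proof (rule label_entropy_kernel[OF V W])
    fix v
    have "(\<Sum>w\<in>W ` space M. \<kappa> v w) = (1 - \<delta>) * (\<Sum>w\<in>W ` space M. of_bool (w = u v)) + \<delta>"
      using l by (simp add: \<kappa>_def sum.distrib sum_distrib_left l_def)
    also have "(\<Sum>w\<in>W ` space M. of_bool (w = u v)) \<le> (1::real)"
      using fin by (simp add: of_bool_def sum.If_cases card_le_Suc0_iff_eq Int_def)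
    finally show "(\<Sum>w\<in>W ` space M. \<kappa> v w) \<le> 1"
      using \<delta> by (simp add: mult_left_le)
  qed (use \<delta> l in \<open>auto simp: \<kappa>_def intro!: add_nonneg_pos\<close>)
  also have "(LINT \<omega>|M. - ln (\<kappa> (V \<omega>) (W \<omega>)))
      \<le> (LINT \<omega>|M. - ln (1 - \<delta>) + ln (l / \<delta>) * indicator ?E \<omega>)"
  proof (rule integral_mono)
    show "integrable M (\<lambda>\<omega>. - ln (\<kappa> (V \<omega>) (W \<omega>)))"
      using integrable_label[OF VW, of "\<lambda>(v, w). - ln (\<kappa> v w)"] by simp
    show "integrable M (\<lambda>\<omega>. - ln (1 - \<delta>) + ln (l / \<delta>) * indicator ?E \<omega>)"
      using E by (intro Bochner_Integration.integrable_add integrable_mult_right) (auto simp: emeasure_eq_measure)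
    fix \<omega> assume \<omega>: "\<omega> \<in> space M"
    have pos: "0 < 1 - \<delta>" "0 < \<delta> / l" using \<delta> l by auto
    have ln1: "ln (1 - \<delta>) \<le> 0" using \<delta> by simp
    show "- ln (\<kappa> (V \<omega>) (W \<omega>)) \<le> - ln (1 - \<delta>) + ln (l / \<delta>) * indicator ?E \<omega>"
    proof (cases "W \<omega> = u (V \<omega>)")
      case True
      then show ?thesis using pos by (simp add: \<kappa>_def)
    next
      case False
      have "- ln (\<delta> / l) = ln (l / \<delta>)" using \<delta> l by (simp add: ln_div)
      then show ?thesis using False \<omega> ln1 by (simp add: \<kappa>_def)
    qed
  qed
  also have "\<dots> = - ln (1 - \<delta>) + prob ?E * ln (l / \<delta>)"
    using E by (subst Bochner_Integration.integral_add) (auto simp: prob_space emeasure_eq_measure mult.commute)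
  finally show ?thesis by (simp add: l_def)
qed

end

section \<open>Subadditive sequences\<close>
lemma subadditive_mult_le:
  fixes u :: "nat \<Rightarrow> real"
  assumes sub: "\<And>m n. u (m + n) \<le> u m + u n"
  shows "u (q * k + t) \<le> real q * u k + u t"
proof (induction q)
  case (Suc q)
  have "u (Suc q * k + t) \<le> u k + u (q * k + t)"
    using sub[of k "q * k + t"] by (simp add: add.assoc)
  then show ?case using Suc by (simp add: algebra_simps)
qed simp

lemma fekete:
  fixes u :: "nat \<Rightarrow> real"
  assumes sub: "\<And>m n. u (m + n) \<le> u m + u n" and nonneg: "\<And>n. 0 \<le> u n"
  shows fekete_convergent: "convergent (\<lambda>n. u n / real n)"
    and fekete_lim_le: "0 < k \<Longrightarrow> lim (\<lambda>n. u n / real n) \<le> u k / real k"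
proof -
  define L where "L = (INF k\<in>{0<..}. u k / real k)"
  have bdd: "bdd_below ((\<lambda>k. u k / real k) ` {0<..})"
    using nonneg by (intro bdd_belowI2[where m=0]) auto
  have L_le: "L \<le> u k / real k" if "0 < k" for k
    unfolding L_def using bdd that by (intro cINF_lower) auto
  have "(\<lambda>n. u n / real n) \<longlonglongrightarrow> L"
  proof (rule LIMSEQ_I)
    fix e :: real assume e: "0 < e"
    have "\<exists>k\<in>{0<..}. u k / real k < L + e / 2"
      using e cINF_less_iff[OF _ bdd, of "L + e / 2"] by (auto simp: L_def)
    then obtain k where k: "0 < k" "u k / real k < L + e / 2" by auto
    \<comment> \<open>A bound for \<open>u\<close> on all possible remainders modulo \<open>k\<close>.\<close>
    define C where "C = (\<Sum>t<k. u t)"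
    have C: "u t \<le> C" if "t < k" for t
      unfolding C_def using that nonneg by (intro member_le_sum) auto
    obtain N where N: "2 * C / e < real N" using reals_Archimedean2 by blast
    show "\<exists>N. \<forall>n\<ge>N. norm (u n / real n - L) < e"
    proof (intro exI allI impI)
      fix n assume n: "n \<ge> Suc N"
      then have n0: "0 < real n" by simp
      have "u n = u (n div k * k + n mod k)" by simp
      also have "\<dots> \<le> real (n div k) * u k + u (n mod k)"
        by (rule subadditive_mult_le[OF sub])
      also have "\<dots> \<le> (real n / real k) * u k + C"
        using k nonneg by (intro add_mono mult_right_mono C of_nat_div_le_of_nat) auto
      finally have "u n / real n \<le> ((real n / real k) * u k + C) / real n"
        using n0 by (intro divide_right_mono) auto
      also have "\<dots> = u k / real k + C / real n"
        using n0 k by (simp add: field_simps)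
      also have "C / real n < e / 2"
      proof -
        have "2 * C < e * real N" using N e by (simp add: field_simps)
        also have "\<dots> \<le> e * real n" using n e by simp
        finally show ?thesis using n0 by (simp add: field_simps)
      qed
      finally have "u n / real n < L + e" using k by simp
      then show "norm (u n / real n - L) < e" using L_le[of n] n e by auto
    qed
  qed
  then show "convergent (\<lambda>n. u n / real n)"
    and "0 < k \<Longrightarrow> lim (\<lambda>n. u n / real n) \<le> u k / real k"
    using L_le by (auto simp: convergent_def limI)
qed

section \<open>Entropy rates and generators\<close>
definition itinerary :: "('a \<Rightarrow> 'a) \<Rightarrow> ('a \<Rightarrow> 'b) \<Rightarrow> nat \<Rightarrow> 'a \<Rightarrow> 'b list" where
  "itinerary T X n \<omega> = map (\<lambda>i. X ((T ^^ i) \<omega>)) [0..<n]"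

lemma itinerary_0 [simp]: "itinerary T X 0 \<omega> = []"
  by (simp add: itinerary_def)

lemma length_itinerary [simp]: "length (itinerary T X n \<omega>) = n"
  by (simp add: itinerary_def)

lemma itinerary_Suc: "itinerary T X (Suc n) \<omega> = itinerary T X n \<omega> @ [X ((T ^^ n) \<omega>)]"
  by (simp add: itinerary_def)

lemma itinerary_funpow: "itinerary T X k ((T ^^ n) \<omega>) = map (\<lambda>i. X ((T ^^ i) \<omega>)) [n..<n + k]"
proof -
  have "itinerary T X k ((T ^^ n) \<omega>) = map (\<lambda>i. X ((T ^^ (i + n)) \<omega>)) [0..<k]"
    by (simp add: itinerary_def funpow_add)
  also have "\<dots> = map (\<lambda>i. X ((T ^^ i) \<omega>)) (map (\<lambda>i. i + n) [0..<k])"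
    by simp
  finally show ?thesis by (simp add: map_add_upt add.commute)
qed

lemma itinerary_add: "itinerary T X (n + k) \<omega> = itinerary T X n \<omega> @ itinerary T X k ((T ^^ n) \<omega>)"
  unfolding itinerary_funpow by (simp add: itinerary_def upt_add_eq_append[of 0 n k])

lemma take_drop_itinerary:
  assumes "n + k \<le> N"
  shows "take k (drop n (itinerary T X N \<omega>)) = itinerary T X k ((T ^^ n) \<omega>)"
proof -
  obtain l where "N = n + k + l" using assms le_Suc_ex by blast
  then show ?thesis by (simp add: itinerary_add)
qed

locale measure_preserving_system = prob_space M for M :: "'a measure" +
  fixes T :: "'a \<Rightarrow> 'a"
  assumes measurable_T [measurable]: "T \<in> measurable M M"
    and distr_T: "distr M M T = M"
begin

lemma measurable_funpow [measurable]: "T ^^ n \<in> measurable M M"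
  by (induction n) (auto simp: measurable_comp)

lemma distr_funpow: "distr M M (T ^^ n) = M"
proof (induction n)
  case 0
  show ?case by (simp add: id_def)
next
  case (Suc n)
  have "distr M M (T ^^ Suc n) = distr (distr M M (T ^^ n)) M T"
    by (subst distr_distr) auto
  then show ?case by (simp only: Suc distr_T)
qed

lemma simple_function_funpow:
  assumes "simple_function M X"
  shows "simple_function M (\<lambda>\<omega>. X ((T ^^ n) \<omega>))"
  using simple_function_comp[OF measurable_funpow assms] by (simp add: comp_def)

lemma mass_funpow:
  assumes X: "simple_function M X"
  shows "mass M (\<lambda>\<omega>. X ((T ^^ n) \<omega>)) v = mass M X v"
proof -
  have "mass M X v = measure (distr M M (T ^^ n)) (X -` {v} \<inter> space M)"
    by (simp add: mass_def distr_funpow)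
  also have "\<dots> = measure M ((T ^^ n) -` (X -` {v} \<inter> space M) \<inter> space M)"
    using simple_functionD[OF X] by (intro measure_distr) auto
  also have "(T ^^ n) -` (X -` {v} \<inter> space M) \<inter> space M = (\<lambda>\<omega>. X ((T ^^ n) \<omega>)) -` {v} \<inter> space M"
    using measurable_space[OF measurable_funpow] by auto
  finally show ?thesis by (simp add: mass_def)
qed

lemma integral_funpow:
  fixes f :: "'a \<Rightarrow> real"
  assumes "f \<in> borel_measurable M"
  shows "(LINT \<omega>|M. f ((T ^^ n) \<omega>)) = (LINT \<omega>|M. f \<omega>)"
  using integral_distr[OF measurable_funpow[of n] assms] by (simp add: distr_funpow)

lemma label_entropy_funpow:
  assumes X: "simple_function M X"
  shows "label_entropy M (\<lambda>\<omega>. X ((T ^^ n) \<omega>)) = label_entropy M X"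
proof -
  have "(\<lambda>\<omega>. - ln (mass M X (X \<omega>))) \<in> borel_measurable M"
    using integrable_label[OF X, of "\<lambda>v. - ln (mass M X v)"] by simp
  then show ?thesis
    using integral_funpow[of "\<lambda>\<omega>. - ln (mass M X (X \<omega>))" n]
    by (simp add: label_entropy_def mass_funpow[OF X])
qed

lemma simple_function_itinerary:
  assumes "simple_function M X"
  shows "simple_function M (itinerary T X n)"
proof (induction n)
  case 0
  show ?case by (simp add: itinerary_def[abs_def])
next
  case (Suc n)
  have "simple_function M (\<lambda>\<omega>. itinerary T X n \<omega> @ [X ((T ^^ n) \<omega>)])"
    by (rule simple_function_compose2[OF Suc simple_function_funpow[OF assms]])
  then show ?case by (simp add: itinerary_Suc[abs_def])
qed

definition entropy_rate :: "('a \<Rightarrow> 'b) \<Rightarrow> real" where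
  "entropy_rate X = lim (\<lambda>n. label_entropy M (itinerary T X n) / real n)"

lemma label_entropy_itinerary_subadditive:
  assumes X: "simple_function M X"
  shows "label_entropy M (itinerary T X (m + n))
    \<le> label_entropy M (itinerary T X m) + label_entropy M (itinerary T X n)"
proof -
  let ?U = "itinerary T X m" and ?V = "\<lambda>\<omega>. itinerary T X n ((T ^^ m) \<omega>)"
  have U: "simple_function M ?U" and V: "simple_function M ?V"
    using simple_function_itinerary[OF X] simple_function_funpow by auto
  have UV: "simple_function M (\<lambda>\<omega>. (?U \<omega>, ?V \<omega>))" using U V by simp
  have "label_entropy M (itinerary T X (m + n)) \<le> label_entropy M (\<lambda>\<omega>. (?U \<omega>, ?V \<omega>))"
    using label_entropy_compose_le[OF UV, of "\<lambda>(a, b). a @ b"]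
    by (simp add: itinerary_add[abs_def])
  also have "\<dots> \<le> label_entropy M ?U + label_entropy M ?V"
    by (rule label_entropy_Pair_le_add[OF U V])
  finally show ?thesis
    by (simp add: label_entropy_funpow[OF simple_function_itinerary[OF X]])
qed

lemma
  assumes X: "simple_function M X"
  shows entropy_rate_LIMSEQ:
      "(\<lambda>n. label_entropy M (itinerary T X n) / real n) \<longlonglongrightarrow> entropy_rate X"
    and entropy_rate_le: "0 < n \<Longrightarrow> entropy_rate X \<le> label_entropy M (itinerary T X n) / real n"
proof -
  note sub = label_entropy_itinerary_subadditive[OF X]
  note nonneg = label_entropy_nonneg[OF simple_function_itinerary[OF X]]
  show "(\<lambda>n. label_entropy M (itinerary T X n) / real n) \<longlonglongrightarrow> entropy_rate X"
    unfolding entropy_rate_def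
    using fekete_convergent[OF sub nonneg] by (simp add: convergent_LIMSEQ_iff)
  show "0 < n \<Longrightarrow> entropy_rate X \<le> label_entropy M (itinerary T X n) / real n"
    unfolding entropy_rate_def by (rule fekete_lim_le[OF sub nonneg])
qed

text \<open>
  Given a long \<open>Y\<close>-itinerary, each further \<open>X\<close>-symbol costs at most the entropy of \<open>X\<close> given the \<open>k\<close>
  letters of \<open>Y\<close> that start at the same time. By invariance this cost does not depend on the time.
\<close>
lemma entropy_rate_le_conditional:
  assumes X: "simple_function M X" and Y: "simple_function M Y"
  shows "entropy_rate X \<le> entropy_rate Y
    + (label_entropy M (\<lambda>\<omega>. (itinerary T Y k \<omega>, X \<omega>)) - label_entropy M (itinerary T Y k))"
proof -
  note sX = simple_function_itinerary[OF X] and sY = simple_function_itinerary[OF Y]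
  define c where "c = label_entropy M (\<lambda>\<omega>. (itinerary T Y k \<omega>, X \<omega>)) - label_entropy M (itinerary T Y k)"
  have sYX: "simple_function M (\<lambda>\<omega>. (itinerary T Y k \<omega>, X \<omega>))" using sY X by simp
  have step: "label_entropy M (\<lambda>\<omega>. (itinerary T Y N \<omega>, itinerary T X n \<omega>))
      \<le> label_entropy M (itinerary T Y N) + real n * c" if "n + k \<le> N" for n N
    using that
  proof (induction n)
    case 0
    show ?case
      using label_entropy_compose_le[OF sY, of "\<lambda>y. (y, [])" N] by simp
  next
    case (Suc n)
    let ?Z = "\<lambda>\<omega>. (itinerary T Y N \<omega>, itinerary T X n \<omega>)" and ?W = "\<lambda>\<omega>. X ((T ^^ n) \<omega>)"
    \<comment> \<open>All that is kept of the past is the window of \<open>Y\<close>-letters seen from time \<open>n\<close> on.\<close>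
    let ?g = "\<lambda>(y, x). take k (drop n y)"
    have Z: "simple_function M ?Z" and W: "simple_function M ?W"
      using sX sY simple_function_funpow[OF X] by auto
    have ZW: "simple_function M (\<lambda>\<omega>. (?Z \<omega>, ?W \<omega>))" using Z W by simp
    have g: "?g (?Z \<omega>) = itinerary T Y k ((T ^^ n) \<omega>)" for \<omega>
      using Suc.prems by (simp add: take_drop_itinerary)
    have "label_entropy M (\<lambda>\<omega>. (itinerary T Y N \<omega>, itinerary T X (Suc n) \<omega>))
        \<le> label_entropy M (\<lambda>\<omega>. (?Z \<omega>, ?W \<omega>))"
      using label_entropy_compose_le[OF ZW, of "\<lambda>((y, x), w). (y, x @ [w])"]
      by (simp add: itinerary_Suc)
    also have "\<dots> \<le> label_entropy M ?Z
        + (label_entropy M (\<lambda>\<omega>. (?g (?Z \<omega>), ?W \<omega>)) - label_entropy M (\<lambda>\<omega>. ?g (?Z \<omega>)))"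
      by (rule label_entropy_Pair_le[OF Z W])
    also have "\<dots> = label_entropy M ?Z + c"
      unfolding g c_def
      using label_entropy_funpow[OF sYX, of n] label_entropy_funpow[OF sY, of k n] by simp
    finally show ?case using Suc by (simp add: algebra_simps)
  qed
  have bound: "label_entropy M (itinerary T X n) / real n
      \<le> label_entropy M (itinerary T Y n) / real n + label_entropy M (itinerary T Y k) / real n + c"
    if "0 < n" for n
  proof -
    have "simple_function M (\<lambda>\<omega>. (itinerary T Y (n + k) \<omega>, itinerary T X n \<omega>))" using sX sY by simp
    then have "label_entropy M (itinerary T X n)
        \<le> label_entropy M (\<lambda>\<omega>. (itinerary T Y (n + k) \<omega>, itinerary T X n \<omega>))"
      using label_entropy_compose_le[of "\<lambda>\<omega>. (itinerary T Y (n + k) \<omega>, itinerary T X n \<omega>)" snd] by simp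
    also have "\<dots> \<le> label_entropy M (itinerary T Y (n + k)) + real n * c"
      by (rule step) simp
    also have "\<dots> \<le> label_entropy M (itinerary T Y n) + label_entropy M (itinerary T Y k) + real n * c"
      using label_entropy_itinerary_subadditive[OF Y, of n k] by simp
    finally show ?thesis using that by (simp add: field_simps)
  qed
  have "entropy_rate X \<le> entropy_rate Y + 0 + c"
  proof (rule LIMSEQ_le)
    show "(\<lambda>n. label_entropy M (itinerary T X n) / real n) \<longlonglongrightarrow> entropy_rate X"
      by (rule entropy_rate_LIMSEQ[OF X])
    show "(\<lambda>n. label_entropy M (itinerary T Y n) / real n + label_entropy M (itinerary T Y k) / real n + c)
        \<longlonglongrightarrow> entropy_rate Y + 0 + c"
      by (intro tendsto_add entropy_rate_LIMSEQ[OF Y] tendsto_const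
          tendsto_divide_0[OF tendsto_const] filterlim_real_at_infinity_sequentially)
    show "\<exists>N. \<forall>n\<ge>N. label_entropy M (itinerary T X n) / real n
        \<le> label_entropy M (itinerary T Y n) / real n + label_entropy M (itinerary T Y k) / real n + c"
      using bound by (intro exI[of _ 1]) auto
  qed
  then show ?thesis by (simp add: c_def)
qed

text \<open>
  The itineraries of \<open>Y\<close> generate the \<open>\<sigma>\<close>-algebra up to null sets, stated as the approximation property
  that the entropy argument needs.
\<close>
definition generator :: "('a \<Rightarrow> 'b) \<Rightarrow> bool" where
  "generator Y \<longleftrightarrow> simple_function M Y \<and>
     (\<forall>B\<in>events. \<forall>\<eta>>0. \<exists>k C. prob (sym_diff B (itinerary T Y k -` C \<inter> space M)) < \<eta>)"

text \<open>
  Each fibre of \<open>X\<close> is approximated by a \<open>Y\<close>-cylinder. Outside the union of the errors exactly one of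
  these cylinders contains the point, and it tells the value of \<open>X\<close>.
\<close>
lemma generator_guess:
  assumes Y: "generator Y" and X: "simple_function M X" and \<eta>: "0 < \<eta>"
  shows "\<exists>k u. prob {\<omega>\<in>space M. X \<omega> \<noteq> u (itinerary T Y k \<omega>)} < \<eta>"
proof -
  let ?R = "X ` space M"
  have sY: "simple_function M Y" using Y by (simp add: generator_def)
  have fin: "finite ?R" and ne: "?R \<noteq> {}"
    using simple_functionD(1)[OF X] not_empty by auto
  define l where "l = real (card ?R)"
  have l: "0 < l" using fin ne by (simp add: l_def card_gt_0_iff)
  have "\<exists>k C. prob (sym_diff (X -` {v} \<inter> space M) (itinerary T Y k -` C \<inter> space M)) < \<eta> / l" for v
    using Y simple_functionD(2)[OF X, of "{v}"] \<eta> l by (simp add: generator_def)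
  then have "\<exists>k. \<forall>v. \<exists>C. prob (sym_diff (X -` {v} \<inter> space M) (itinerary T Y (k v) -` C \<inter> space M)) < \<eta> / l"
    by (intro choice allI)
  then obtain k where "\<forall>v. \<exists>C. prob (sym_diff (X -` {v} \<inter> space M) (itinerary T Y (k v) -` C \<inter> space M)) < \<eta> / l"
    by (rule exE)
  from choice[OF this] obtain C where kC:
    "\<And>v. prob (sym_diff (X -` {v} \<inter> space M) (itinerary T Y (k v) -` C v \<inter> space M)) < \<eta> / l"
    by auto
  define K where "K = Max (k ` ?R)"
  define u where "u w = (SOME v. v \<in> ?R \<and> take (k v) w \<in> C v)" for w
  define D where "D v = sym_diff (X -` {v} \<inter> space M) (itinerary T Y (k v) -` C v \<inter> space M)" for v
  have D: "D v \<in> events" for v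
    unfolding D_def
    using simple_functionD(2)[OF X] simple_functionD(2)[OF simple_function_itinerary[OF sY]] by auto
  have take: "take (k v) (itinerary T Y K \<omega>) = itinerary T Y (k v) \<omega>" if "v \<in> ?R" for v \<omega>
  proof -
    have "k v \<le> K" using that fin by (auto simp: K_def)
    then show ?thesis using take_drop_itinerary[of 0 "k v" K T Y \<omega>] by simp
  qed
  have "{\<omega>\<in>space M. X \<omega> \<noteq> u (itinerary T Y K \<omega>)} \<subseteq> (\<Union>v\<in>?R. D v)"
  proof
    fix \<omega> assume \<omega>: "\<omega> \<in> {\<omega>\<in>space M. X \<omega> \<noteq> u (itinerary T Y K \<omega>)}"
    show "\<omega> \<in> (\<Union>v\<in>?R. D v)"
    proof (rule ccontr)
      assume n: "\<omega> \<notin> (\<Union>v\<in>?R. D v)"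
      have "itinerary T Y (k v) \<omega> \<in> C v \<longleftrightarrow> v = X \<omega>" if "v \<in> ?R" for v
      proof -
        have "\<omega> \<notin> D v" using n that by blast
        then show ?thesis using \<omega> by (auto simp: D_def)
      qed
      then have "(\<lambda>v. v \<in> ?R \<and> take (k v) (itinerary T Y K \<omega>) \<in> C v) = (\<lambda>v. v = X \<omega>)"
        using \<omega> take by fastforce
      then have "u (itinerary T Y K \<omega>) = X \<omega>"
        by (simp add: u_def)
      then show False using \<omega> by simp
    qed
  qed
  then have "prob {\<omega>\<in>space M. X \<omega> \<noteq> u (itinerary T Y K \<omega>)} \<le> prob (\<Union>v\<in>?R. D v)"
    by (rule finite_measure_mono) (rule sets.finite_UN[OF fin D])
  also have "\<dots> \<le> (\<Sum>v\<in>?R. prob (D v))"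
    using D fin by (intro finite_measure_subadditive_finite) auto
  also have "\<dots> < (\<Sum>v\<in>?R. \<eta> / l)"
    using fin ne kC by (intro sum_strict_mono) (auto simp: D_def)
  also have "\<dots> = \<eta>" using l by (simp add: l_def)
  finally show ?thesis by blast
qed

text \<open>
  By \<open>generator_guess\<close> a long \<open>Y\<close>-itinerary predicts \<open>X\<close> up to a small error, and \<open>fano_inequality\<close>
  makes the correction term in \<open>entropy_rate_le_conditional\<close> arbitrarily small.
\<close>
theorem entropy_rate_le_generator:
  assumes Y: "generator Y" and X: "simple_function M X"
  shows "entropy_rate X \<le> entropy_rate Y"
proof (rule field_le_epsilon)
  fix \<epsilon> :: real assume \<epsilon>: "0 < \<epsilon>"
  have sY: "simple_function M Y" using Y by (simp add: generator_def)
  \<comment> \<open>The two terms in Fano's inequality become at most \<open>\<epsilon> / 2\<close> each.\<close>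
  define \<delta> where "\<delta> = 1 - exp (- \<epsilon> / 2)"
  have \<delta>: "0 < \<delta>" "\<delta> < 1" "- ln (1 - \<delta>) = \<epsilon> / 2" using \<epsilon> by (auto simp: \<delta>_def)
  define c where "c = ln (real (card (X ` space M)) / \<delta>)"
  define \<eta> where "\<eta> = \<epsilon> / (2 * (\<bar>c\<bar> + 1))"
  have \<eta>: "0 < \<eta>" using \<epsilon> by (simp add: \<eta>_def)
  obtain k u where ku: "prob {\<omega>\<in>space M. X \<omega> \<noteq> u (itinerary T Y k \<omega>)} < \<eta>"
    using generator_guess[OF Y X \<eta>] by blast
  have "entropy_rate X \<le> entropy_rate Y
      + (label_entropy M (\<lambda>\<omega>. (itinerary T Y k \<omega>, X \<omega>)) - label_entropy M (itinerary T Y k))"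
    by (rule entropy_rate_le_conditional[OF X sY])
  also have "\<dots> \<le> entropy_rate Y + (\<epsilon> / 2 + prob {\<omega>\<in>space M. X \<omega> \<noteq> u (itinerary T Y k \<omega>)} * c)"
    using fano_inequality[OF simple_function_itinerary[OF sY] X \<delta>(1,2), of k u] \<delta>(3)
    by (simp add: c_def)
  also have "prob {\<omega>\<in>space M. X \<omega> \<noteq> u (itinerary T Y k \<omega>)} * c \<le> \<eta> * (\<bar>c\<bar> + 1)"
  proof -
    have "prob {\<omega>\<in>space M. X \<omega> \<noteq> u (itinerary T Y k \<omega>)} * c
        \<le> prob {\<omega>\<in>space M. X \<omega> \<noteq> u (itinerary T Y k \<omega>)} * (\<bar>c\<bar> + 1)"
      by (intro mult_left_mono) auto
    also have "\<dots> \<le> \<eta> * (\<bar>c\<bar> + 1)"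
      using ku by (intro mult_right_mono) auto
    finally show ?thesis .
  qed
  also have "\<eta> * (\<bar>c\<bar> + 1) = \<epsilon> / 2" by (simp add: \<eta>_def field_simps)
  finally show "entropy_rate X \<le> entropy_rate Y + \<epsilon>" by simp
qed

text \<open>
  The fibres of \<open>X\<close> are the nonempty members of \<open>P\<close>. Empty members must be tolerated, because
  common refinements of partitions contain them.
\<close>
definition codes :: "('a \<Rightarrow> 'b) \<Rightarrow> 'a set set \<Rightarrow> bool" where
  "codes X P \<longleftrightarrow> simple_function M X \<and> finite P
     \<and> P - {{}} = (\<lambda>v. X -` {v} \<inter> space M) ` (X ` space M)"

lemma partition_entropy_codes:
  assumes "codes X P"
  shows "partition_entropy M P = label_entropy M X"
proof -
  let ?f = "\<lambda>v. X -` {v} \<inter> space M"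
  have X: "simple_function M X" and fin: "finite P" and P: "P - {{}} = ?f ` (X ` space M)"
    using assms by (auto simp: codes_def)
  have inj: "inj_on ?f (X ` space M)"
    by (rule inj_onI) blast
  have "partition_entropy M P = - (\<Sum>B\<in>P - {{}}. prob B * ln (prob B))"
    unfolding partition_entropy_def
    using fin by (intro arg_cong[where f=uminus] sum.mono_neutral_right) auto
  also have "\<dots> = (\<Sum>v\<in>X ` space M. - ln (mass M X v) * mass M X v)"
    unfolding P sum.reindex[OF inj] sum_negf[symmetric] by (simp add: mass_def mult.commute)
  finally show ?thesis by (simp add: label_entropy_sum[OF X])
qed

lemma codes_refinement:
  assumes "codes X P"
  shows "codes (itinerary T X n) (refinement M T P n)"
proof (induction n)
  case 0
  have "itinerary T X 0 ` space M = {[]}" using not_empty by auto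
  then show ?case
    using not_empty simple_function_itinerary[of X 0] assms by (auto simp: codes_def vimage_def)
next
  case (Suc n)
  let ?f = "\<lambda>v. X -` {v} \<inter> space M"
  let ?F = "\<lambda>n w. itinerary T X n -` {w} \<inter> space M"
  let ?R = "refinement M T P"
  have X: "simple_function M X" and finP: "finite P" and P: "P - {{}} = ?f ` (X ` space M)"
    using assms by (auto simp: codes_def)
  have finR: "finite (?R n)" and R: "?R n - {{}} = ?F n ` (itinerary T X n ` space M)"
    using Suc by (auto simp: codes_def)
  have eq: "?R (Suc n) = (\<lambda>(B, C). B \<inter> ((T ^^ n) -` C \<inter> space M)) ` (?R n \<times> P)"
    by auto
  have T: "(T ^^ n) \<omega> \<in> space M" if "\<omega> \<in> space M" for \<omega>
    using measurable_space[OF measurable_funpow that] .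
  have split: "?F (Suc n) (itinerary T X (Suc n) \<omega>)
      = ?F n (itinerary T X n \<omega>) \<inter> ((T ^^ n) -` ?f (X ((T ^^ n) \<omega>)) \<inter> space M)" for \<omega>
    using T by (auto simp: itinerary_Suc)
  have "?R (Suc n) - {{}} = ?F (Suc n) ` (itinerary T X (Suc n) ` space M)"
  proof (intro equalityI subsetI)
    fix D assume D: "D \<in> ?R (Suc n) - {{}}"
    then obtain B C where BC: "B \<in> ?R n" "C \<in> P" "D = B \<inter> ((T ^^ n) -` C \<inter> space M)" by auto
    obtain \<omega> where \<omega>: "\<omega> \<in> D" using D by auto
    have "B \<in> ?F n ` (itinerary T X n ` space M)" "C \<in> ?f ` (X ` space M)"
      unfolding R[symmetric] P[symmetric] using BC \<omega> by auto
    then have "B = ?F n (itinerary T X n \<omega>)" "C = ?f (X ((T ^^ n) \<omega>))" "\<omega> \<in> space M"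
      using BC \<omega> by auto
    then show "D \<in> ?F (Suc n) ` (itinerary T X (Suc n) ` space M)"
      using BC(3) split[of \<omega>] by blast
  next
    fix D assume "D \<in> ?F (Suc n) ` (itinerary T X (Suc n) ` space M)"
    then obtain \<omega> where \<omega>: "\<omega> \<in> space M" "D = ?F (Suc n) (itinerary T X (Suc n) \<omega>)" by auto
    have "?F n (itinerary T X n \<omega>) \<in> ?R n - {{}}" unfolding R using \<omega> by blast
    moreover have "?f (X ((T ^^ n) \<omega>)) \<in> P - {{}}" unfolding P using T[OF \<omega>(1)] by blast
    ultimately have "D \<in> ?R (Suc n)"
      unfolding eq \<omega>(2) split by blast
    moreover have "\<omega> \<in> D" using \<omega> by simp
    ultimately show "D \<in> ?R (Suc n) - {{}}" by blast
  qed
  moreover have "finite (?R (Suc n))" unfolding eq using finR finP by auto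
  ultimately show ?case using simple_function_itinerary[OF X] by (simp add: codes_def del: refinement.simps)
qed

lemma entropy_wrt_codes:
  assumes "codes X P"
  shows "entropy_wrt M T P = entropy_rate X"
  unfolding entropy_wrt_def entropy_rate_def partition_entropy_codes[OF codes_refinement[OF assms]] ..

lemma codes_fibres:
  assumes X: "simple_function M X"
  shows "codes X ((\<lambda>v. X -` {v} \<inter> space M) ` (X ` space M))"
    and "finite_partition M ((\<lambda>v. X -` {v} \<inter> space M) ` (X ` space M))"
  using simple_functionD[OF X] X
  by (auto simp: codes_def finite_partition_def disjoint_def)

text \<open>
  A point is labelled by the set of all members that contain it, a singleton. Unlike the member itself
  this label needs no choice and is defined at every point.
\<close>
lemma finite_partition_coded:
  assumes P: "finite_partition M P"
  shows "codes (\<lambda>\<omega>. {B\<in>P. \<omega> \<in> B}) P"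
proof -
  let ?X = "\<lambda>\<omega>. {B\<in>P. \<omega> \<in> B}"
  have fin: "finite P" and meas: "P \<subseteq> events" and disj: "disjoint P" and un: "\<Union>P = space M"
    using P by (auto simp: finite_partition_def)
  have X: "?X \<omega> = {B}" if "B \<in> P" "\<omega> \<in> B" for B \<omega>
    using that disj by (auto simp: disjoint_def)
  have fibre: "?X -` {{B}} \<inter> space M = B" if "B \<in> P" for B
    using that X un by (auto dest: equalityD2)
  have range: "?X ` space M = (\<lambda>B. {B}) ` (P - {{}})"
  proof (intro equalityI subsetI)
    fix V assume "V \<in> ?X ` space M"
    then obtain \<omega> where \<omega>: "\<omega> \<in> space M" "V = ?X \<omega>" by auto
    then obtain B where "B \<in> P" "\<omega> \<in> B" using un by auto
    then show "V \<in> (\<lambda>B. {B}) ` (P - {{}})" using X \<omega> by auto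
  next
    fix V assume "V \<in> (\<lambda>B. {B}) ` (P - {{}})"
    then obtain B \<omega> where B: "B \<in> P" "\<omega> \<in> B" "V = {B}" by auto
    then have "\<omega> \<in> space M" "V = ?X \<omega>" using un X by auto
    then show "V \<in> ?X ` space M" by blast
  qed
  have "simple_function M ?X"
    unfolding simple_function_def range using fin meas fibre by auto
  moreover have "P - {{}} = (\<lambda>v. ?X -` {v} \<inter> space M) ` (?X ` space M)"
    unfolding range image_image using fibre by auto
  ultimately show ?thesis using fin by (simp add: codes_def)
qed

text \<open>
  The Kolmogorov-Sinai theorem. Every finite partition is coded by a random variable, to which
  \<open>entropy_rate_le_generator\<close> applies; the fibres of \<open>Y\<close> are themselves a partition.
\<close>
theorem metric_entropy_generator:
  assumes Y: "generator Y"
  shows "metric_entropy M T = ereal (entropy_rate Y)"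
proof (rule antisym)
  have sY: "simple_function M Y" using Y by (simp add: generator_def)
  show "metric_entropy M T \<le> ereal (entropy_rate Y)"
    unfolding metric_entropy_def
  proof (rule SUP_least)
    fix P assume "P \<in> {P. finite_partition M P}"
    then have c: "codes (\<lambda>\<omega>. {B\<in>P. \<omega> \<in> B}) P" using finite_partition_coded by simp
    then have "entropy_wrt M T P \<le> entropy_rate Y"
      unfolding entropy_wrt_codes[OF c]
      by (intro entropy_rate_le_generator[OF Y]) (simp add: codes_def)
    then show "ereal (entropy_wrt M T P) \<le> ereal (entropy_rate Y)" by simp
  qed
  show "ereal (entropy_rate Y) \<le> metric_entropy M T"
    unfolding metric_entropy_def
    using codes_fibres[OF sY]
    by (intro SUP_upper2[where i="(\<lambda>v. Y -` {v} \<inter> space M) ` (Y ` space M)"])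
       (auto simp: entropy_wrt_codes)
qed

end

context measure_preserving_system
begin

text \<open>
  Events that can be approximated by cylinders form a \<open>\<sigma>\<close>-algebra. A countable union is first cut off
  after finitely many members, whose approximating cylinders are then taken of a common length.
\<close>
lemma generatorI:
  assumes Y: "simple_function M Y"
    and gen: "sets M = sigma_sets (space M) {itinerary T Y k -` C \<inter> space M | k C. True}"
  shows "generator Y"
proof -
  let ?cyl = "\<lambda>k C. itinerary T Y k -` C \<inter> space M"
  let ?G = "{?cyl k C | k C. True}"
  have cyl[measurable, simp]: "?cyl k C \<in> events" for k C
    using simple_functionD(2)[OF simple_function_itinerary[OF Y]] .
  have lift: "?cyl k C = ?cyl K {w. take k w \<in> C}" if "k \<le> K" for k K C
    using that take_drop_itinerary[of 0 k K T Y] by auto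
  have "\<exists>k C. prob (sym_diff B (?cyl k C)) < \<eta>" if "B \<in> events" "0 < \<eta>" for B \<eta>
  proof -
    have int: "Int_stable ?G"
    proof (rule Int_stableI)
      fix a b assume "a \<in> ?G" "b \<in> ?G"
      then obtain k C l D where ab: "a = ?cyl k C" "b = ?cyl l D" by auto
      have "a = ?cyl (max k l) {w. take k w \<in> C}" "b = ?cyl (max k l) {w. take l w \<in> D}"
        unfolding ab by (rule lift, simp)+
      then have "a \<inter> b = ?cyl (max k l) ({w. take k w \<in> C} \<inter> {w. take l w \<in> D})"
        by blast
      then show "a \<inter> b \<in> ?G" by blast
    qed
    have G: "?G \<subseteq> Pow (space M)" by blast
    have "B \<in> sigma_sets (space M) ?G" using that(1) unfolding gen .
    from int G this have "\<forall>\<eta>>0. \<exists>k C. prob (sym_diff B (?cyl k C)) < \<eta>"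
    proof (induction rule: sigma_sets_induct_disjoint)
      case (basic A)
      then obtain k C where A: "A = ?cyl k C" by auto
      have "sym_diff A A = {}" by auto
      then have "prob (sym_diff A (?cyl k C)) = 0" using A by (metis measure_empty)
      then show ?case by metis
    next
      case empty
      have "sym_diff {} (?cyl 0 {}) = {}" by auto
      then have "prob (sym_diff {} (?cyl 0 {})) = 0" by (metis measure_empty)
      then show ?case by metis
    next
      case (compl A)
      have "sym_diff (space M - A) (?cyl k (- C)) = sym_diff A (?cyl k C)" for k C
        using sets.sets_into_space[of A M, unfolded gen, OF compl(1)] by blast
      with compl(2) show ?case by metis
    next
      case (union A)
      have A[measurable]: "A i \<in> events" for i using union(2) unfolding gen by blast
      show ?case
      proof (intro allI impI)
        fix \<eta> :: real assume \<eta>: "0 < \<eta>"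
        have "(\<lambda>n. prob (\<Union>i<n. A i)) \<longlonglongrightarrow> prob (\<Union>n. \<Union>i<n. A i)"
          by (intro finite_Lim_measure_incseq) (auto simp: incseq_def intro: less_le_trans)
        moreover have "(\<Union>n. \<Union>i<n. A i) = (\<Union>i. A i)" by auto
        ultimately have "(\<lambda>n. prob (\<Union>i<n. A i)) \<longlonglongrightarrow> prob (\<Union>i. A i)" by simp
        from order_tendstoD(1)[OF this, of "prob (\<Union>i. A i) - \<eta> / 2"]
        obtain N where N: "prob (\<Union>i. A i) - \<eta> / 2 < prob (\<Union>i<N. A i)"
          using \<eta> by (auto simp: eventually_sequentially)
        define e where "e = \<eta> / (2 * real (Suc N))"
        have e: "0 < e" using \<eta> by (simp add: e_def)
        have "\<exists>k C. prob (sym_diff (A i) (?cyl k C)) < e" for i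
          using union(3) e by blast
        then have "\<exists>k. \<forall>i. \<exists>C. prob (sym_diff (A i) (?cyl (k i) C)) < e"
          by (intro choice allI)
        then obtain k where "\<forall>i. \<exists>C. prob (sym_diff (A i) (?cyl (k i) C)) < e"
          by (rule exE)
        from choice[OF this] obtain C where kC: "\<And>i. prob (sym_diff (A i) (?cyl (k i) (C i))) < e"
          by auto
        define K where "K = (\<Sum>i<N. k i)"
        have k_le: "k i \<le> K" if "i < N" for i
          unfolding K_def using that by (intro member_le_sum) auto
        define D where "D = {w. \<exists>i<N. take (k i) w \<in> C i}"
        have D: "?cyl K D = (\<Union>i<N. ?cyl (k i) (C i))"
          using lift[OF k_le] unfolding D_def by auto
        let ?S = "\<lambda>i. sym_diff (A i) (?cyl (k i) (C i))"
        have "sym_diff (\<Union>i. A i) (?cyl K D) \<subseteq> ((\<Union>i. A i) - (\<Union>i<N. A i)) \<union> (\<Union>i<N. ?S i)"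
          unfolding D by auto
        then have "prob (sym_diff (\<Union>i. A i) (?cyl K D))
            \<le> prob (((\<Union>i. A i) - (\<Union>i<N. A i)) \<union> (\<Union>i<N. ?S i))"
          by (intro finite_measure_mono) auto
        also have "\<dots> \<le> prob ((\<Union>i. A i) - (\<Union>i<N. A i)) + prob (\<Union>i<N. ?S i)"
          by (intro measure_Un_le) auto
        also have "prob ((\<Union>i. A i) - (\<Union>i<N. A i)) = prob (\<Union>i. A i) - prob (\<Union>i<N. A i)"
          by (intro finite_measure_Diff) auto
        also have "prob (\<Union>i<N. ?S i) \<le> (\<Sum>i<N. prob (?S i))"
          by (intro finite_measure_subadditive_finite) auto
        also have "\<dots> \<le> (\<Sum>i<N. e)"
          using kC by (intro sum_mono less_imp_le)
        also have "\<dots> \<le> \<eta> / 2"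
          using \<eta> by (simp add: e_def field_simps)
        finally have "prob (sym_diff (\<Union>i. A i) (?cyl K D)) < \<eta>"
          using N by simp
        then show "\<exists>k C. prob (sym_diff (\<Union>i. A i) (?cyl k C)) < \<eta>" by blast
      qed
    qed
    then show ?thesis using that by blast
  qed
  then show ?thesis using Y by (simp add: generator_def)
qed

end

section \<open>The full shift on two symbols\<close>
definition initial_word :: "nat \<Rightarrow> (nat \<Rightarrow> 'b) \<Rightarrow> 'b list" where
  "initial_word n x = map x [0..<n]"

lemma length_initial_word [simp]: "length (initial_word n x) = n"
  by (simp add: initial_word_def)

lemma nth_initial_word [simp]: "i < n \<Longrightarrow> initial_word n x ! i = x i"
  by (simp add: initial_word_def)

lemma initial_word_0 [simp]: "initial_word 0 x = []"
  by (simp add: initial_word_def)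

lemma initial_word_Suc: "initial_word (Suc n) x = initial_word n x @ [x n]"
  by (simp add: initial_word_def)

lemma initial_word_eq_iff: "initial_word n x = initial_word n y \<longleftrightarrow> (\<forall>i<n. x i = y i)"
  by (auto simp: initial_word_def)

lemma space_Sigma2: "space Sigma2 = {x. \<forall>i. x i \<in> {1, 2}}"
  by (auto simp: Sigma2_def Sigma2_top_def space_measure_of_conv PiE_def Pi_def)

lemma topspace_Sigma2_top: "topspace Sigma2_top = space Sigma2"
  by (simp add: Sigma2_def space_measure_of_conv)

text \<open>
  Only finitely many coordinates are restricted in a basic open set, so cylinders over initial words form a
  base of the topology.
\<close>
lemma openin_Sigma2_top_iff:
  "openin Sigma2_top U \<longleftrightarrow>
     U \<subseteq> space Sigma2 \<and> (\<forall>x\<in>U. \<exists>n. \<forall>y\<in>space Sigma2. initial_word n y = initial_word n x \<longrightarrow> y \<in> U)"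
proof (intro iffI conjI ballI)
  assume U: "openin Sigma2_top U"
  show "U \<subseteq> space Sigma2" using openin_subset[OF U] by (simp add: topspace_Sigma2_top)
  fix x assume "x \<in> U"
  then obtain V where fin: "finite {i. V i \<noteq> {1, 2 :: nat}}" and x: "x \<in> Pi\<^sub>E UNIV V" and VU: "Pi\<^sub>E UNIV V \<subseteq> U"
    using U unfolding Sigma2_top_def openin_product_topology_alt by auto
  obtain n where n: "\<forall>i\<in>{i. V i \<noteq> {1, 2}}. i < n"
    using fin finite_nat_set_iff_bounded by blast
  show "\<exists>n. \<forall>y\<in>space Sigma2. initial_word n y = initial_word n x \<longrightarrow> y \<in> U"
  proof (intro exI ballI impI)
    fix y assume y: "y \<in> space Sigma2" "initial_word n y = initial_word n x"
    have "y i \<in> V i" for i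
      using y n x by (cases "i < n") (auto simp: initial_word_eq_iff space_Sigma2 PiE_def Pi_def)
    then show "y \<in> U" using VU by auto
  qed
next
  assume U: "U \<subseteq> space Sigma2 \<and> (\<forall>x\<in>U. \<exists>n. \<forall>y\<in>space Sigma2. initial_word n y = initial_word n x \<longrightarrow> y \<in> U)"
  show "openin Sigma2_top U"
    unfolding Sigma2_top_def openin_product_topology_alt
  proof (intro ballI)
    fix x assume x: "x \<in> U"
    then obtain n where n: "\<And>y. y \<in> space Sigma2 \<Longrightarrow> initial_word n y = initial_word n x \<Longrightarrow> y \<in> U"
      using U by blast
    have x12: "x i \<in> {1, 2}" for i using x U by (auto simp: space_Sigma2)
    define V where "V i = (if i < n then {x i} else {1, 2})" for i
    have "{i. V i \<noteq> {1, 2}} \<subseteq> {..<n}" by (auto simp: V_def)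
    then have "finite {i. V i \<noteq> {1, 2}}" by (rule finite_subset) simp
    moreover have "Pi\<^sub>E UNIV V \<subseteq> U"
    proof
      fix y assume y: "y \<in> Pi\<^sub>E UNIV V"
      then have yV: "y i \<in> V i" for i by auto
      have "y i \<in> {1, 2}" for i using yV[of i] x12[of i] by (auto simp: V_def split: if_splits)
      moreover have "y i = x i" if "i < n" for i using yV[of i] that by (simp add: V_def)
      ultimately show "y \<in> U" by (intro n) (auto simp: space_Sigma2 initial_word_eq_iff)
    qed
    moreover have "x \<in> Pi\<^sub>E UNIV V" "\<forall>i. V i \<subseteq> {1, 2}" using x12 by (auto simp: V_def)
    ultimately show "\<exists>V. finite {i \<in> UNIV. V i \<noteq> topspace (discrete_topology {1, 2})} \<and>
        (\<forall>i\<in>UNIV. openin (discrete_topology {1, 2}) (V i)) \<and> x \<in> Pi\<^sub>E UNIV V \<and> Pi\<^sub>E UNIV V \<subseteq> U"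
      by (intro exI[of _ V]) auto
  qed
qed

text \<open>
  An open set is the union, over the countably many lengths \<open>n\<close>, of the largest cylinders of length \<open>n\<close>
  inside it.
\<close>
lemma sets_Sigma2: "sets Sigma2 = sigma_sets (space Sigma2) {initial_word n -` C \<inter> space Sigma2 | n C. True}"
  (is "_ = sigma_sets _ ?G")
proof -
  have "sets Sigma2 = sigma_sets (space Sigma2) {U. openin Sigma2_top U}"
    unfolding topspace_Sigma2_top[symmetric]
    using openin_subset by (subst Sigma2_def, intro sets_measure_of) auto
  also have "\<dots> = sigma_sets (space Sigma2) ?G"
  proof (rule sigma_sets_eqI)
    fix U assume "U \<in> {U. openin Sigma2_top U}"
    then have U: "U \<subseteq> space Sigma2"
      "\<And>x. x \<in> U \<Longrightarrow> \<exists>n. \<forall>y\<in>space Sigma2. initial_word n y = initial_word n x \<longrightarrow> y \<in> U"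
      by (auto simp: openin_Sigma2_top_iff)
    define D where "D n = {w. \<forall>y\<in>space Sigma2. initial_word n y = w \<longrightarrow> y \<in> U}" for n
    have "U = (\<Union>n. initial_word n -` D n \<inter> space Sigma2)"
    proof (intro equalityI subsetI)
      fix x assume x: "x \<in> U"
      obtain n where "\<forall>y\<in>space Sigma2. initial_word n y = initial_word n x \<longrightarrow> y \<in> U"
        using U(2)[OF x] by (rule exE)
      then have "initial_word n x \<in> D n" by (simp add: D_def)
      then show "x \<in> (\<Union>n. initial_word n -` D n \<inter> space Sigma2)" using x U(1) by auto
    next
      fix x assume "x \<in> (\<Union>n. initial_word n -` D n \<inter> space Sigma2)"
      then obtain n where "initial_word n x \<in> D n" "x \<in> space Sigma2" by auto
      then show "x \<in> U" by (simp add: D_def)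
    qed
    also have "\<dots> \<in> sigma_sets (space Sigma2) ?G"
    proof (rule sigma_sets.Union)
      fix n
      have "initial_word n -` D n \<inter> space Sigma2 \<in> ?G" by blast
      then show "initial_word n -` D n \<inter> space Sigma2 \<in> sigma_sets (space Sigma2) ?G"
        by (rule sigma_sets.Basic)
    qed
    finally show "U \<in> sigma_sets (space Sigma2) ?G" .
  next
    fix U assume "U \<in> ?G"
    then obtain n C where "U = initial_word n -` C \<inter> space Sigma2" by auto
    then have "openin Sigma2_top U"
      by (auto simp: openin_Sigma2_top_iff intro!: exI[of _ n])
    then show "U \<in> sigma_sets (space Sigma2) {U. openin Sigma2_top U}" by auto
  qed
  finally show ?thesis .
qed

lemma cylinder_in_sets_Sigma2: "initial_word n -` C \<inter> space Sigma2 \<in> sets Sigma2"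
  unfolding sets_Sigma2 by (rule sigma_sets.Basic) blast

lemma simple_function_initial_word:
  fixes M :: "(nat \<Rightarrow> nat) measure"
  assumes "\<And>i. simple_function M (\<lambda>x. x i)"
  shows "simple_function M (initial_word n)"
proof (induction n)
  case 0
  show ?case by (simp add: initial_word_def[abs_def])
next
  case (Suc n)
  have "simple_function M (\<lambda>x. initial_word n x @ [x n])"
    by (rule simple_function_compose2[OF Suc assms])
  then show ?case by (simp add: initial_word_Suc[abs_def])
qed

lemma simple_function_coordinate_Sigma2:
  assumes "sets M = sets Sigma2"
  shows "simple_function M (\<lambda>x. x i)"
proof -
  have sp: "space M = space Sigma2" using assms by (rule sets_eq_imp_space_eq)
  have "(\<lambda>x. x i) ` space M \<subseteq> {1, 2}" by (auto simp: sp space_Sigma2)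
  then have fin: "finite ((\<lambda>x. x i) ` space M)" by (rule finite_subset) simp
  have "(\<lambda>x. x i) -` {v} \<inter> space M = initial_word (Suc i) -` {w. w ! i = v} \<inter> space Sigma2" for v
    by (auto simp: sp)
  then have "(\<lambda>x. x i) -` {v} \<inter> space M \<in> sets M" for v
    using cylinder_in_sets_Sigma2 assms by metis
  then show ?thesis using fin by (simp add: simple_function_def)
qed

lemma simple_function_initial_word_Sigma2:
  "sets M = sets Sigma2 \<Longrightarrow> simple_function M (initial_word n)"
  by (intro simple_function_initial_word simple_function_coordinate_Sigma2)

lemma sets_PiM_Sigma2:
  assumes M: "\<And>i. sets (M i) = Pow {1, 2 :: nat}"
  shows "sets (PiM UNIV M) = sets Sigma2"
proof (rule antisym)
  have sp: "space (M i) = {1, 2}" for i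
    using M[of i] by (metis Pow_top sets.sets_into_space sets.top Pow_iff subset_antisym)
  then have sp_eq: "space (PiM UNIV M) = space Sigma2"
    by (auto simp: space_PiM space_Sigma2 PiE_def Pi_def)
  have "simple_function (M i) (\<lambda>j. j)" for i
    using M sp by (auto simp: simple_function_def)
  then have "simple_function (PiM UNIV M) (\<lambda>x. x i)" for i
    using simple_function_comp[OF measurable_component_singleton[of i UNIV M], of "\<lambda>j. j"] by simp
  then have "initial_word n -` C \<inter> space (PiM UNIV M) \<in> sets (PiM UNIV M)" for n C
    using simple_function_initial_word simple_functionD(2) by blast
  then have "{initial_word n -` C \<inter> space Sigma2 | n C. True} \<subseteq> sets (PiM UNIV M)"
    unfolding sp_eq by auto
  then show "sets Sigma2 \<subseteq> sets (PiM UNIV M)"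
    unfolding sets_Sigma2 sp_eq[symmetric] by (rule sets.sigma_sets_subset)
  have "{{f \<in> \<Pi>\<^sub>E i\<in>UNIV. space (M i). f i \<in> A} | i A. i \<in> UNIV \<and> A \<in> sets (M i)} \<subseteq> sets Sigma2"
  proof clarify
    fix i A assume "A \<in> sets (M i)"
    have "{f \<in> \<Pi>\<^sub>E i\<in>UNIV. space (M i). f i \<in> A} = (\<lambda>x. x i) -` A \<inter> space Sigma2"
      unfolding sp_eq[symmetric] space_PiM by auto
    then show "{f \<in> \<Pi>\<^sub>E i\<in>UNIV. space (M i). f i \<in> A} \<in> sets Sigma2"
      using simple_functionD(2)[OF simple_function_coordinate_Sigma2[OF refl]] by metis
  qed
  then show "sets (PiM UNIV M) \<subseteq> sets Sigma2"
    unfolding sets_PiM_single space_PiM[symmetric] sp_eq by (rule sets.sigma_sets_subset)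
qed

lemma (in prob_space) prob_label:
  assumes X: "simple_function M X"
  shows "prob (X -` C \<inter> space M) = (\<Sum>v\<in>X ` space M. indicator C v * mass M X v)"
proof -
  have "(LINT \<omega>|M. indicator C (X \<omega>)) = (LINT \<omega>|M. indicator (X -` C \<inter> space M) \<omega> :: real)"
    by (intro Bochner_Integration.integral_cong) (auto simp: indicator_def)
  also have "\<dots> = prob (X -` C \<inter> space M)"
    using simple_functionD(2)[OF X] by simp
  finally show ?thesis using integral_label[OF X, of "indicator C"] by simp
qed

lemma Sigma2_measure_eqI:
  assumes M: "prob_space M" "sets M = sets Sigma2" and N: "prob_space N" "sets N = sets Sigma2"
    and eq: "\<And>n w. mass M (initial_word n) w = mass N (initial_word n) w"
  shows "M = N"
proof -
  interpret M: prob_space M by fact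
  interpret N: prob_space N by fact
  have sp: "space M = space Sigma2" "space N = space Sigma2"
    using sets_eq_imp_space_eq M(2) N(2) by blast+
  let ?E = "{initial_word n -` C \<inter> space Sigma2 | n C. True}"
  have "measure M (initial_word n -` C \<inter> space Sigma2) = measure N (initial_word n -` C \<inter> space Sigma2)" for n C
    using M.prob_label[OF simple_function_initial_word_Sigma2[OF M(2)], of n C]
      N.prob_label[OF simple_function_initial_word_Sigma2[OF N(2)], of n C]
    by (simp add: sp eq)
  then have meas: "emeasure M X = emeasure N X" if "X \<in> ?E" for X
    using that by (auto simp: M.emeasure_eq_measure N.emeasure_eq_measure)
  have int: "Int_stable ?E"
  proof (rule Int_stableI)
    fix a b assume "a \<in> ?E" "b \<in> ?E"
    then obtain k C l D where ab: "a = initial_word k -` C \<inter> space Sigma2" "b = initial_word l -` D \<inter> space Sigma2"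
      by auto
    have "take k (initial_word (max k l) x) = initial_word k x" "take l (initial_word (max k l) x) = initial_word l x" for x :: "nat \<Rightarrow> nat"
      by (auto simp: initial_word_def take_map)
    then have "a \<inter> b = initial_word (max k l) -` {w. take k w \<in> C \<and> take l w \<in> D} \<inter> space Sigma2"
      unfolding ab by auto
    then show "a \<inter> b \<in> ?E" by blast
  qed
  show ?thesis
  proof (rule measure_eqI_generator_eq[OF int _ meas])
    show "sets M = sigma_sets (space Sigma2) ?E" "sets N = sigma_sets (space Sigma2) ?E"
      by (rule trans[OF M(2) sets_Sigma2], rule trans[OF N(2) sets_Sigma2])
    have "space Sigma2 = initial_word 0 -` UNIV \<inter> space Sigma2" by simp
    then have "space Sigma2 \<in> ?E" by blast
    then show "range (\<lambda>_::nat. space Sigma2) \<subseteq> ?E" by simp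
    show "(\<Union>i::nat. space Sigma2) = space Sigma2" by simp
    show "emeasure M (space Sigma2) \<noteq> \<infinity>" for i :: nat by (simp add: M.emeasure_eq_measure)
  qed blast
qed

lemma funpow_left_shift: "(left_shift ^^ n) x = (\<lambda>i. x (i + n))"
  by (induction n) (auto simp: left_shift_def)

lemma measurable_left_shift: "left_shift \<in> measurable Sigma2 Sigma2"
proof (rule measurable_sigma_sets[OF sets_Sigma2])
  show "left_shift \<in> space Sigma2 \<rightarrow> space Sigma2"
    by (auto simp: space_Sigma2 left_shift_def)
  fix A :: "(nat \<Rightarrow> nat) set" assume "A \<in> {initial_word n -` C \<inter> space Sigma2 | n C. True}"
  then obtain n C where A: "A = initial_word n -` C \<inter> space Sigma2" by auto
  have "initial_word (Suc n) x = x 0 # initial_word n (left_shift x)" for x :: "nat \<Rightarrow> nat"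
    unfolding initial_word_def left_shift_def upt_conv_Cons[OF zero_less_Suc]
    by (simp add: map_Suc_upt[symmetric] comp_def del: upt_Suc)
  then have "left_shift -` A \<inter> space Sigma2 = initial_word (Suc n) -` {w. tl w \<in> C} \<inter> space Sigma2"
    by (auto simp: A space_Sigma2 left_shift_def)
  then show "left_shift -` A \<inter> space Sigma2 \<in> sets Sigma2"
    using simple_functionD(2)[OF simple_function_initial_word_Sigma2[OF refl]] by metis
qed auto

lemma invariant_measures_system:
  assumes "\<nu> \<in> invariant_measures"
  shows "measure_preserving_system \<nu> left_shift"
proof -
  have p: "prob_space \<nu>" and s: "sets \<nu> = sets Sigma2"
    and inv: "\<And>B. B \<in> sets \<nu> \<Longrightarrow> emeasure \<nu> (left_shift -` B \<inter> space \<nu>) = emeasure \<nu> B"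
    using assms by (auto simp: invariant_measures_def)
  have m: "left_shift \<in> measurable \<nu> \<nu>"
    using measurable_left_shift measurable_cong_sets[OF s s] by auto
  have "distr \<nu> \<nu> left_shift = \<nu>"
    by (rule measure_eqI) (auto simp: emeasure_distr[OF m] inv)
  then show ?thesis
    using p m by (simp add: measure_preserving_system_def measure_preserving_system_axioms_def)
qed

lemma itinerary_coordinate: "itinerary left_shift (\<lambda>x. x 0) n = initial_word n"
  by (simp add: itinerary_def funpow_left_shift initial_word_def fun_eq_iff)

text \<open>
  The first symbol is a generator whose itineraries are the initial words. The last property is the
  part of Fekete's lemma that compares the limit with each single term.
\<close>
lemma metric_entropy_left_shift:
  assumes \<nu>: "\<nu> \<in> invariant_measures"
  obtains h where "metric_entropy \<nu> left_shift = ereal h"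
    and "(\<lambda>n. label_entropy \<nu> (initial_word n) / real n) \<longlonglongrightarrow> h"
    and "\<And>n. real n * h \<le> label_entropy \<nu> (initial_word n)"
proof -
  note sys = invariant_measures_system[OF \<nu>]
  interpret measure_preserving_system \<nu> left_shift by fact
  have s: "sets \<nu> = sets Sigma2" using \<nu> by (simp add: invariant_measures_def)
  have sp: "space \<nu> = space Sigma2" using s by (rule sets_eq_imp_space_eq)
  note coord = simple_function_coordinate_Sigma2[OF s, of 0]
  have gen: "generator (\<lambda>x. x 0)"
    by (rule generatorI[OF coord], unfold itinerary_coordinate sp) (rule trans[OF s sets_Sigma2])
  show ?thesis
  proof
    show "metric_entropy \<nu> left_shift = ereal (entropy_rate (\<lambda>x. x 0))"
      by (rule metric_entropy_generator[OF gen])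
    show "(\<lambda>n. label_entropy \<nu> (initial_word n) / real n) \<longlonglongrightarrow> entropy_rate (\<lambda>x. x 0)"
      using entropy_rate_LIMSEQ[OF coord] by (simp add: itinerary_coordinate)
    show "real n * entropy_rate (\<lambda>x. x 0) \<le> label_entropy \<nu> (initial_word n)" for n
      using entropy_rate_le[OF coord, of n] label_entropy_nonneg[OF simple_function_initial_word_Sigma2[OF s], of n]
      by (cases "n = 0") (auto simp: itinerary_coordinate field_simps)
  qed
qed

section \<open>Norms of the matrix products\<close>
text \<open>
  The number of the first \<open>n\<close> steps that double the image of the first basis vector. That image lies on the
  first axis at even times, where the second matrix doubles it, and on the second axis at odd times, where
  the first matrix does. The other basis vector is doubled at the remaining \<open>n - gain x n\<close> steps.
\<close>
definition gain :: "(nat \<Rightarrow> nat) \<Rightarrow> nat \<Rightarrow> nat" where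
  "gain x n = (\<Sum>i<n. of_bool ((x i \<noteq> 1) = even i))"

lemma gain_0 [simp]: "gain x 0 = 0"
  and gain_Suc: "gain x (Suc n) = gain x n + of_bool ((x n \<noteq> 1) = even n)"
  by (simp_all add: gain_def)

lemma gain_le: "gain x n \<le> n"
  by (induction n) (auto simp: gain_Suc)

lemma gain_add:
  "gain x (n + m) = gain x n +
     (if even n then gain ((left_shift ^^ n) x) m else m - gain ((left_shift ^^ n) x) m)"
proof (induction m)
  case (Suc m)
  show ?case
    using Suc gain_le[of "(left_shift ^^ n) x" m]
    by (auto simp: gain_Suc funpow_left_shift add.commute)
qed simp

lemma gain_initial_word: "gain x n = gain ((!) (initial_word n x)) n"
  by (simp add: gain_def)

lemma cocycle_mult_vec:
  "cocycle AA x n *v v =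
     (if even n then vector [2 ^ gain x n * v $ 1, 2 ^ (n - gain x n) * v $ 2]
      else vector [2 ^ (n - gain x n) * v $ 2, 2 ^ gain x n * v $ 1])"
proof (induction n)
  case 0
  show ?case by (simp add: vec_eq_iff forall_2)
next
  case (Suc n)
  have "Suc n - gain x n = Suc (n - gain x n)" using gain_le[of x n] by simp
  moreover have step: "cocycle AA x (Suc n) *v v = AA (x n) *v (cocycle AA x n *v v)"
    by (simp add: matrix_vector_mul_assoc)
  ultimately show ?case
    unfolding step Suc.IH
    by (auto simp: AA_def gain_Suc vec_eq_iff forall_2 matrix_vector_mult_def sum_2)
qed

lemma norm_vec2: "norm (v :: real^2) = sqrt ((v $ 1)\<^sup>2 + (v $ 2)\<^sup>2)"
  by (simp add: norm_vec_def L2_set_def sum_2)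

lemma onorm_cocycle: "onorm ((*v) (cocycle AA x n)) = 2 ^ max (gain x n) (n - gain x n)"
proof (rule antisym)
  let ?a = "2 ^ gain x n :: real" and ?b = "2 ^ (n - gain x n) :: real"
    and ?m = "2 ^ max (gain x n) (n - gain x n) :: real"
  have norm_eq: "norm (cocycle AA x n *v v) = sqrt ((?a * v $ 1)\<^sup>2 + (?b * v $ 2)\<^sup>2)" for v
    unfolding cocycle_mult_vec norm_vec2 by (auto simp: add.commute)
  show "onorm ((*v) (cocycle AA x n)) \<le> ?m"
  proof (rule onorm_le)
    fix v :: "real^2"
    have "(?a * v $ 1)\<^sup>2 \<le> (?m * v $ 1)\<^sup>2" "(?b * v $ 2)\<^sup>2 \<le> (?m * v $ 2)\<^sup>2"
      unfolding power_mult_distrib by (intro mult_right_mono power_mono power_increasing; simp)+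
    then have "sqrt ((?a * v $ 1)\<^sup>2 + (?b * v $ 2)\<^sup>2) \<le> sqrt (?m\<^sup>2 * ((v $ 1)\<^sup>2 + (v $ 2)\<^sup>2))"
      by (intro real_sqrt_le_mono) (simp add: power_mult_distrib distrib_left)
    then show "norm (cocycle AA x n *v v) \<le> ?m * norm v"
      by (simp add: norm_eq norm_vec2[of v] real_sqrt_mult)
  qed
  have low: "norm (cocycle AA x n *v v) \<le> onorm ((*v) (cocycle AA x n)) * norm v" for v
    by (rule onorm) (rule matrix_vector_mul_bounded_linear)
  have "?a \<le> onorm ((*v) (cocycle AA x n))" "?b \<le> onorm ((*v) (cocycle AA x n))"
    using low[of "vector [1, 0]"] low[of "vector [0, 1]"]
    by (simp_all add: norm_eq norm_vec2[of "vector _"])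
  then show "?m \<le> onorm ((*v) (cocycle AA x n))" by (simp add: max_def)
qed

definition log_norm :: "nat \<Rightarrow> (nat \<Rightarrow> nat) \<Rightarrow> real" where
  "log_norm n x = real (max (gain x n) (n - gain x n)) * ln 2"

lemma ln_onorm_cocycle: "ln (onorm ((*v) (cocycle AA x n))) = log_norm n x"
  by (simp add: onorm_cocycle log_norm_def ln_realpow)

lemma log_norm_subadditive: "log_norm (n + m) x \<le> log_norm n x + log_norm m ((left_shift ^^ n) x)"
proof -
  have "max (gain x (n + m)) (n + m - gain x (n + m))
      \<le> max (gain x n) (n - gain x n)
        + max (gain ((left_shift ^^ n) x) m) (m - gain ((left_shift ^^ n) x) m)"
    using gain_le[of x n] gain_le[of "(left_shift ^^ n) x" m] by (auto simp: gain_add)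
  from of_nat_mono[OF this, where 'a=real] show ?thesis
    unfolding log_norm_def distrib_right[symmetric] of_nat_add by (rule mult_right_mono) simp
qed

lemma log_norm_initial_word: "log_norm n x = log_norm n ((!) (initial_word n x))"
  by (simp add: log_norm_def gain_initial_word[of x])

text \<open>
  The integrals of the logarithmic norms are subadditive by invariance, so the limit in the definition exists
  and is a lower bound for all its terms.
\<close>
lemma lyapunov_AA:
  assumes \<nu>: "\<nu> \<in> invariant_measures"
  shows lyapunov_LIMSEQ: "(\<lambda>n. (LINT x|\<nu>. log_norm n x) / real n) \<longlonglongrightarrow> lyapunov AA \<nu>"
    and lyapunov_le: "real n * lyapunov AA \<nu> \<le> (LINT x|\<nu>. log_norm n x)"
proof -
  interpret measure_preserving_system \<nu> left_shift by (rule invariant_measures_system[OF \<nu>])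
  have s: "sets \<nu> = sets Sigma2" using \<nu> by (simp add: invariant_measures_def)
  have int: "integrable \<nu> (log_norm n)" for n
    using integrable_label[OF simple_function_initial_word_Sigma2[OF s], of "\<lambda>w. log_norm n ((!) w)" n]
    by (simp add: log_norm_initial_word[symmetric])
  have int': "integrable \<nu> (\<lambda>x. log_norm m ((left_shift ^^ n) x))" for m n
    using int[of m] integrable_distr_eq[OF measurable_funpow[of n], of "log_norm m"]
    by (simp add: distr_funpow)
  let ?L = "\<lambda>n. LINT x|\<nu>. log_norm n x"
  have sub: "?L (n + m) \<le> ?L n + ?L m" for n m
  proof -
    have "?L (n + m) \<le> (LINT x|\<nu>. log_norm n x + log_norm m ((left_shift ^^ n) x))"
      by (intro integral_mono int Bochner_Integration.integrable_add int' log_norm_subadditive)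
    also have "\<dots> = ?L n + (LINT x|\<nu>. log_norm m ((left_shift ^^ n) x))"
      by (rule Bochner_Integration.integral_add[OF int int'])
    also have "(LINT x|\<nu>. log_norm m ((left_shift ^^ n) x)) = ?L m"
      using int[of m] by (intro integral_funpow) simp
    finally show ?thesis .
  qed
  have nonneg: "0 \<le> ?L n" for n
    by (intro integral_nonneg_AE) (simp add: log_norm_def)
  have eq: "lyapunov AA \<nu> = lim (\<lambda>n. ?L n / real n)"
    unfolding lyapunov_def ln_onorm_cocycle by simp
  show "(\<lambda>n. ?L n / real n) \<longlonglongrightarrow> lyapunov AA \<nu>"
    unfolding eq using fekete_convergent[OF sub nonneg] by (simp add: convergent_LIMSEQ_iff)
  show "real n * lyapunov AA \<nu> \<le> ?L n"
    using fekete_lim_le[OF sub nonneg, of n] nonneg[of n]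
    by (cases "n = 0") (auto simp: eq field_simps)
qed

section \<open>The average of the two alternating product measures\<close>
text \<open>
  The parameter \<open>r\<close> stands for \<open>2\<^sup>s\<close>, which exceeds 1 because \<open>s\<close> is positive.
\<close>
locale gibbs_weights =
  fixes r :: real
  assumes r_gt_1: "1 < r"
begin

text \<open>
  The probability of symbol \<open>j\<close> at position \<open>i\<close>. The phase \<open>\<theta>\<close> matters modulo 2 only: phase 0 favours the
  steps counted by \<open>gain\<close>, phase 1 the others.
\<close>
definition weight :: "nat \<Rightarrow> nat \<Rightarrow> nat \<Rightarrow> real" where
  "weight \<theta> i j = (if (j \<noteq> 1) = even (i + \<theta>) then r else 1) / (1 + r)"

definition alternating :: "nat \<Rightarrow> (nat \<Rightarrow> nat) measure" where
  "alternating \<theta> = PiM UNIV (\<lambda>i. point_measure {1, 2} (\<lambda>j. ennreal (weight \<theta> i j)))"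

definition mixture :: "(nat \<Rightarrow> nat) measure" where
  "mixture = measure_pmf (bernoulli_pmf (1 / 2)) \<bind> (\<lambda>b. alternating (of_bool b))"

lemma weight_pos: "0 < weight \<theta> i j"
  using r_gt_1 by (simp add: weight_def)

lemma weight_shift: "weight \<theta> (Suc i) j = weight (Suc \<theta>) i j"
  and weight_period: "weight (Suc (Suc \<theta>)) i j = weight \<theta> i j"
  by (simp_all add: weight_def)

lemma weight_sum: "weight \<theta> i 1 + weight \<theta> i 2 = 1"
  using r_gt_1 unfolding weight_def by (cases "even (i + \<theta>)") (auto simp: add_divide_distrib[symmetric])

lemma alternating_period: "alternating (Suc (Suc \<theta>)) = alternating \<theta>"
  by (simp add: alternating_def weight_period)

lemma prob_space_site: "prob_space (point_measure {1, 2 :: nat} (\<lambda>j. ennreal (weight \<theta> i j)))"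
proof (rule prob_spaceI)
  have "emeasure (point_measure {1, 2} (\<lambda>j. ennreal (weight \<theta> i j))) {1, 2}
      = ennreal (weight \<theta> i 1) + ennreal (weight \<theta> i 2)"
    by (subst emeasure_point_measure_finite) auto
  also have "\<dots> = ennreal (weight \<theta> i 1 + weight \<theta> i 2)"
    using weight_pos[of \<theta> i 1] weight_pos[of \<theta> i 2] by (intro ennreal_plus[symmetric]) auto
  also have "\<dots> = 1" by (simp only: weight_sum ennreal_1)
  finally show "emeasure (point_measure {1, 2} (\<lambda>j. ennreal (weight \<theta> i j)))
      (space (point_measure {1, 2} (\<lambda>j. ennreal (weight \<theta> i j)))) = 1"
    by (simp add: space_point_measure)
qed

lemma prob_space_alternating: "prob_space (alternating \<theta>)"
  unfolding alternating_def by (intro prob_space_PiM prob_space_site)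

lemma sets_alternating: "sets (alternating \<theta>) = sets Sigma2"
  unfolding alternating_def by (rule sets_PiM_Sigma2) (simp add: sets_point_measure)

lemma space_alternating: "space (alternating \<theta>) = space Sigma2"
  by (rule sets_eq_imp_space_eq[OF sets_alternating])

lemma measure_alternating:
  assumes J: "finite J" and v: "\<And>i. i \<in> J \<Longrightarrow> v i \<in> {1, 2}"
  shows "measure (alternating \<theta>) {x\<in>space Sigma2. \<forall>i\<in>J. x i = v i} = (\<Prod>i\<in>J. weight \<theta> i (v i))"
proof -
  let ?M = "\<lambda>i. point_measure {1, 2 :: nat} (\<lambda>j. ennreal (weight \<theta> i j))"
  interpret product_prob_space ?M UNIV
    by (intro product_prob_spaceI prob_space_site)
  have "emeasure (PiM UNIV ?M) {x\<in>space (PiM UNIV ?M). \<forall>i\<in>J. x i \<in> {v i}}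
      = (\<Prod>i\<in>J. emeasure (?M i) {v i})"
    using J v by (intro emeasure_PiM_Collect) (auto simp: sets_point_measure)
  also have "\<dots> = (\<Prod>i\<in>J. ennreal (weight \<theta> i (v i)))"
    using v by (intro prod.cong refl) (subst emeasure_point_measure_finite, auto)
  also have "\<dots> = ennreal (\<Prod>i\<in>J. weight \<theta> i (v i))"
    using weight_pos by (intro prod_ennreal) (simp add: less_imp_le)
  finally show ?thesis
    unfolding alternating_def[symmetric] space_alternating
    using weight_pos by (simp add: measure_def prod_nonneg less_imp_le)
qed

lemma mass_initial_word_notin:
  assumes "w \<notin> initial_word n ` space M"
  shows "mass M (initial_word n) w = 0"
proof -
  have "initial_word n -` {w} \<inter> space M = {}" using assms by auto
  then show ?thesis by (simp add: mass_def)
qed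

text \<open>
  Shifting the sequence moves every position by one and so reverses the phase.
\<close>
lemma distr_alternating: "distr (alternating \<theta>) Sigma2 left_shift = alternating (Suc \<theta>)"
proof (rule Sigma2_measure_eqI)
  interpret prob_space "alternating \<theta>" by (rule prob_space_alternating)
  have m: "left_shift \<in> measurable (alternating \<theta>) Sigma2"
    using measurable_left_shift measurable_cong_sets[OF sets_alternating refl] by blast
  show "prob_space (distr (alternating \<theta>) Sigma2 left_shift)"
    by (rule prob_space_distr[OF m])
  fix n and w :: "nat list"
  show "mass (distr (alternating \<theta>) Sigma2 left_shift) (initial_word n) w
      = mass (alternating (Suc \<theta>)) (initial_word n) w"
  proof (cases "w \<in> initial_word n ` space Sigma2")
    case False
    then show ?thesis
      by (simp add: mass_initial_word_notin space_alternating)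
  next
    case True
    then obtain z where z: "z \<in> space Sigma2" "w = initial_word n z" by auto
    then have z12: "z i \<in> {1, 2}" for i by (simp add: space_Sigma2)
    have "mass (distr (alternating \<theta>) Sigma2 left_shift) (initial_word n) w
        = measure (alternating \<theta>) (left_shift -` (initial_word n -` {w} \<inter> space Sigma2) \<inter> space (alternating \<theta>))"
      unfolding mass_def by (simp add: measure_distr[OF m] cylinder_in_sets_Sigma2)
    also have "left_shift -` (initial_word n -` {w} \<inter> space Sigma2) \<inter> space (alternating \<theta>)
        = {x\<in>space Sigma2. \<forall>i\<in>Suc ` {..<n}. x i = z (i - 1)}"
      by (auto simp: z(2) initial_word_eq_iff left_shift_def space_alternating space_Sigma2)
    also have "measure (alternating \<theta>) \<dots> = (\<Prod>i\<in>Suc ` {..<n}. weight \<theta> i (z (i - 1)))"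
      using z12 by (intro measure_alternating) auto
    also have "\<dots> = (\<Prod>i<n. weight (Suc \<theta>) i (z i))"
      by (simp add: prod.reindex weight_shift)
    also have "\<dots> = measure (alternating (Suc \<theta>)) {x\<in>space Sigma2. \<forall>i\<in>{..<n}. x i = z i}"
      using z12 by (intro measure_alternating[symmetric]) auto
    also have "{x\<in>space Sigma2. \<forall>i\<in>{..<n}. x i = z i} = initial_word n -` {w} \<inter> space (alternating (Suc \<theta>))"
      by (auto simp: z(2) initial_word_eq_iff space_alternating)
    finally show ?thesis by (simp add: mass_def)
  qed
qed (simp_all add: prob_space_alternating sets_alternating)

lemma measurable_alternating:
  "(\<lambda>b. alternating (of_bool b)) \<in> measurable (measure_pmf p) (prob_algebra Sigma2)"
  by (auto simp: space_prob_algebra prob_space_alternating sets_alternating)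

lemma
  shows prob_space_mixture: "prob_space mixture"
    and sets_mixture: "sets mixture = sets Sigma2"
  unfolding mixture_def
  by (rule prob_space_bind'[OF _ measurable_alternating] sets_bind'[OF _ measurable_alternating];
      simp add: space_prob_algebra measure_pmf.prob_space_axioms)+

lemma space_mixture: "space mixture = space Sigma2"
  by (rule sets_eq_imp_space_eq[OF sets_mixture])

lemma measure_mixture:
  assumes A: "A \<in> sets Sigma2"
  shows "measure mixture A = (measure (alternating 0) A + measure (alternating (Suc 0)) A) / 2"
proof -
  interpret A0: prob_space "alternating 0" by (rule prob_space_alternating)
  interpret A1: prob_space "alternating (Suc 0)" by (rule prob_space_alternating)
  interpret prob_space mixture by (rule prob_space_mixture)
  have "emeasure mixture A
      = (\<integral>\<^sup>+b. emeasure (alternating (of_bool b)) A \<partial>measure_pmf (bernoulli_pmf (1 / 2)))"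
    unfolding mixture_def
    by (rule emeasure_bind_prob_algebra[OF _ measurable_alternating A])
       (simp add: space_prob_algebra measure_pmf.prob_space_axioms)
  also have "\<dots> = ennreal ((measure (alternating 0) A + measure (alternating (Suc 0)) A) / 2)"
    by (subst nn_integral_bernoulli_pmf)
       (simp_all add: A0.emeasure_eq_measure A1.emeasure_eq_measure ennreal_mult'[symmetric]
        ennreal_plus[symmetric] add_divide_distrib add.commute del: ennreal_plus ennreal_half)
  finally show ?thesis
    by (simp add: emeasure_eq_measure)
qed

lemma mixture_invariant: "mixture \<in> invariant_measures"
proof -
  interpret prob_space mixture by (rule prob_space_mixture)
  have "emeasure mixture (left_shift -` B \<inter> space mixture) = emeasure mixture B"
    if B: "B \<in> sets Sigma2" for B
  proof -
    have shift: "measure (alternating \<theta>) (left_shift -` B \<inter> space Sigma2) = measure (alternating (Suc \<theta>)) B" for \<theta>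
    proof -
      have m: "left_shift \<in> measurable (alternating \<theta>) Sigma2"
        using measurable_left_shift measurable_cong_sets[OF sets_alternating refl] by blast
      show ?thesis
        unfolding distr_alternating[symmetric]
        by (simp add: measure_distr[OF m B] space_alternating)
    qed
    have "left_shift -` B \<inter> space Sigma2 \<in> sets Sigma2"
      using measurable_sets[OF measurable_left_shift B] .
    then show ?thesis
      using shift[of 0] shift[of 1] alternating_period[of 0] B
      by (simp add: emeasure_eq_measure measure_mixture space_mixture)
  qed
  then show ?thesis
    by (simp add: invariant_measures_def prob_space_mixture sets_mixture)
qed

lemma prod_weight:
  "(\<Prod>i<n. weight 0 i (x i)) = r ^ gain x n / (1 + r) ^ n"
  "(\<Prod>i<n. weight (Suc 0) i (x i)) = r ^ (n - gain x n) / (1 + r) ^ n"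
proof (induction n)
  case (Suc n)
  {
    case 1
    then show ?case using Suc by (simp add: weight_def gain_Suc field_simps)
  next
    case 2
    have "Suc n - gain x n = Suc (n - gain x n)" using gain_le[of x n] by simp
    then show ?case using Suc by (auto simp: weight_def gain_Suc field_simps)
  }
qed simp_all

text \<open>
  The Gibbs property: the larger of the two powers is the norm of the matrix product raised to the power \<open>s\<close>,
  so this mass lies between one half and one times that power divided by \<open>(1 + r)\<^sup>n\<close>.
\<close>
lemma mass_mixture:
  assumes x: "x \<in> space Sigma2"
  shows "mass mixture (initial_word n) (initial_word n x)
    = (r ^ gain x n + r ^ (n - gain x n)) / (2 * (1 + r) ^ n)"
proof -
  have eq: "initial_word n -` {initial_word n x} \<inter> space Sigma2 = {y\<in>space Sigma2. \<forall>i\<in>{..<n}. y i = x i}"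
    by (auto simp: initial_word_eq_iff)
  have "measure (alternating \<theta>) (initial_word n -` {initial_word n x} \<inter> space Sigma2) = (\<Prod>i<n. weight \<theta> i (x i))" for \<theta>
    unfolding eq using x by (intro measure_alternating) (auto simp: space_Sigma2)
  then show ?thesis
    unfolding mass_def space_mixture measure_mixture[OF cylinder_in_sets_Sigma2]
    by (simp add: prod_weight add_divide_distrib)
qed

end

section \<open>Second moments of sums over the coordinates\<close>
text \<open>
  Expand the square: only pairs of indices at distance less than \<open>m\<close> contribute, and there are at most
  \<open>2 m n\<close> of them.
\<close>
lemma (in prob_space) second_moment_sum_le:
  fixes D :: "nat \<Rightarrow> 'a \<Rightarrow> real"
  assumes meas: "\<And>i. D i \<in> borel_measurable M"
    and bounded: "\<And>i \<omega>. \<bar>D i \<omega>\<bar> \<le> 1"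
    and uncorrelated: "\<And>i k. i + m \<le> k \<Longrightarrow> (LINT \<omega>|M. D i \<omega> * D k \<omega>) = 0"
  shows "(LINT \<omega>|M. (\<Sum>i<n. D i \<omega>)\<^sup>2) \<le> 2 * real m * real n"
proof -
  have bd: "\<bar>D i \<omega> * D k \<omega>\<bar> \<le> 1" for i k \<omega>
    using mult_mono[OF bounded[of i \<omega>] bounded[of k \<omega>]] by (simp add: abs_mult)
  have int: "integrable M (\<lambda>\<omega>. D i \<omega> * D k \<omega>)" for i k
    using bd meas by (intro integrable_const_bound[where B=1]) auto
  have cov_le: "(LINT \<omega>|M. D i \<omega> * D k \<omega>) \<le> of_bool (i < k + m \<and> k < i + m)" for i k
  proof (cases "i < k + m \<and> k < i + m")
    case True
    have "(LINT \<omega>|M. D i \<omega> * D k \<omega>) \<le> (LINT \<omega>|M. 1)"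
      using bd by (intro integral_mono int) (auto intro: order_trans[OF abs_ge_self])
    then show ?thesis using True by (simp add: prob_space)
  next
    case False
    then show ?thesis
      using uncorrelated[of i k] uncorrelated[of k i] by (auto simp: not_less mult.commute)
  qed
  have "(LINT \<omega>|M. (\<Sum>i<n. D i \<omega>)\<^sup>2) = (LINT \<omega>|M. (\<Sum>i<n. \<Sum>k<n. D i \<omega> * D k \<omega>))"
    by (simp add: power2_eq_square sum_product)
  also have "\<dots> = (\<Sum>i<n. \<Sum>k<n. (LINT \<omega>|M. D i \<omega> * D k \<omega>))"
    using int by (simp add: Bochner_Integration.integral_sum)
  also have "\<dots> \<le> (\<Sum>i<n. \<Sum>k<n. of_bool (i < k + m \<and> k < i + m))"
    by (intro sum_mono cov_le)
  also have "\<dots> \<le> (\<Sum>i<n. 2 * real m)"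
  proof (rule sum_mono)
    fix i
    have "(\<Sum>k<n. of_bool (i < k + m \<and> k < i + m)) = real (card {k. k < n \<and> i < k + m \<and> k < i + m})"
      by (simp add: of_bool_def sum.If_cases Int_def)
    also have "card {k. k < n \<and> i < k + m \<and> k < i + m} \<le> card {Suc i - m..<i + m}"
      by (intro card_mono) auto
    also have "\<dots> \<le> 2 * m" by simp
    finally show "(\<Sum>k<n. of_bool (i < k + m \<and> k < i + m)) \<le> 2 * real m" by simp
  qed
  finally show ?thesis by (simp add: mult.commute)
qed

definition cylinder :: "nat set \<Rightarrow> (nat \<Rightarrow> nat) \<Rightarrow> (nat \<Rightarrow> nat) set" where
  "cylinder J v = {x\<in>space Sigma2. \<forall>i\<in>J. x i = v i}"

lemma cylinder_Un: "cylinder (J \<union> K) v = cylinder J v \<inter> cylinder K v"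
  by (auto simp: cylinder_def)

lemma cylinder_cong: "(\<And>i. i \<in> J \<Longrightarrow> v i = w i) \<Longrightarrow> cylinder J v = cylinder J w"
  by (auto simp: cylinder_def)

lemma sets_cylinder:
  assumes "finite J"
  shows "cylinder J v \<in> sets Sigma2"
proof -
  obtain n where n: "\<forall>i\<in>J. i < n" using assms finite_nat_set_iff_bounded by blast
  then have "cylinder J v = initial_word n -` {w. \<forall>i\<in>J. w ! i = v i} \<inter> space Sigma2"
    by (auto simp: cylinder_def)
  then show ?thesis using cylinder_in_sets_Sigma2 by metis
qed

context gibbs_weights
begin

lemma measure_alternating_cylinder:
  assumes "finite J" "\<And>i. v i \<in> {1, 2}"
  shows "measure (alternating \<theta>) (cylinder J v) = (\<Prod>i\<in>J. weight \<theta> i (v i))"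
  unfolding cylinder_def using assms by (intro measure_alternating) auto

lemma cylinders_independent:
  assumes J: "finite J" and K: "finite K" and disj: "J \<inter> K = {}"
    and v: "\<And>i. v i \<in> {1, 2}" and w: "\<And>i. w i \<in> {1, 2}"
  shows "measure (alternating \<theta>) (cylinder J v \<inter> cylinder K w)
    = measure (alternating \<theta>) (cylinder J v) * measure (alternating \<theta>) (cylinder K w)"
proof -
  define u where "u i = (if i \<in> J then v i else w i)" for i
  have u: "u i \<in> {1, 2}" for i using v w by (simp add: u_def)
  have "cylinder J v = cylinder J u" "cylinder K w = cylinder K u"
    using disj by (auto intro!: cylinder_cong simp: u_def)
  then show ?thesis
    using J K disj u
    by (simp add: cylinder_Un[symmetric] measure_alternating_cylinder prod.union_disjoint)
qed

text \<open>
  Cylinders over disjoint sets of positions are independent under the product measure.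
\<close>
lemma alternating_second_moment:
  fixes \<theta> :: nat
  defines "c \<equiv> \<lambda>J v. measure (alternating \<theta>) (cylinder J v)"
  assumes J: "\<And>i. finite (J i)" and v: "\<And>i t. v i t \<in> {1, 2}"
    and disj: "\<And>i k. i + m \<le> k \<Longrightarrow> J i \<inter> J k = {}"
  shows "(LINT x|alternating \<theta>. (\<Sum>i<n. indicator (cylinder (J i) (v i)) x - c (J i) (v i))\<^sup>2)
    \<le> 2 * real m * real n"
proof -
  interpret prob_space "alternating \<theta>" by (rule prob_space_alternating)
  let ?A = "\<lambda>i. cylinder (J i) (v i)"
  have A[measurable]: "?A i \<in> events" for i
    using sets_cylinder[OF J] by (simp add: sets_alternating)
  have intI: "integrable (alternating \<theta>) (indicator B :: _ \<Rightarrow> real)" if "B \<in> events" for B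
    using that by (simp add: emeasure_eq_measure)
  show ?thesis
  proof (rule second_moment_sum_le)
    fix i k :: nat assume ik: "i + m \<le> k"
    have "(LINT x|alternating \<theta>. (indicator (?A i) x - prob (?A i)) * (indicator (?A k) x - prob (?A k)))
        = (LINT x|alternating \<theta>. indicator (?A i \<inter> ?A k) x - prob (?A k) * indicator (?A i) x
            - prob (?A i) * indicator (?A k) x + prob (?A i) * prob (?A k))"
      by (intro Bochner_Integration.integral_cong) (auto simp: indicator_def algebra_simps)
    also have "\<dots> = prob (?A i \<inter> ?A k) - prob (?A i) * prob (?A k)"
      using A intI[OF A] intI[OF sets.Int[OF A A]]
      by (simp add: prob_space Bochner_Integration.integral_diff Bochner_Integration.integral_add)
    also have "\<dots> = 0"
      using cylinders_independent[OF J J disj[OF ik] v v] by simp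
    finally show "(LINT x|alternating \<theta>. (indicator (?A i) x - c (J i) (v i)) * (indicator (?A k) x - c (J k) (v k))) = 0"
      by (simp add: c_def)
  next
    fix i x
    show "\<bar>indicator (?A i) x - c (J i) (v i)\<bar> \<le> 1"
      using prob_le_1[of "?A i"] measure_nonneg[of "alternating \<theta>" "?A i"]
      unfolding c_def by (auto simp: indicator_def)
  qed simp
qed

section \<open>The variational inequality\<close>
text \<open>
  Recovers \<open>s\<close> from \<open>r = 2\<^sup>s\<close>.
\<close>
definition exponent :: real where
  "exponent = ln r / ln 2"

lemma ln_mass_mixture_bounds:
  assumes x: "x \<in> space Sigma2"
  shows ln_mass_mixture_ge:
      "real n * ln (1 + r) - exponent * log_norm n x \<le> - ln (mass mixture (initial_word n) (initial_word n x))"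
    and ln_mass_mixture_le:
      "- ln (mass mixture (initial_word n) (initial_word n x))
        \<le> real n * ln (1 + r) - exponent * log_norm n x + ln 2"
proof -
  define a where "a = max (gain x n) (n - gain x n)"
  define p where "p = r ^ gain x n + r ^ (n - gain x n)"
  have p: "r ^ a \<le> p" "p \<le> 2 * r ^ a"
  proof -
    have "r ^ gain x n \<le> r ^ a" "r ^ (n - gain x n) \<le> r ^ a"
      using r_gt_1 by (auto simp: a_def intro!: power_increasing)
    moreover have "0 \<le> r ^ gain x n" "0 \<le> r ^ (n - gain x n)" using r_gt_1 by auto
    ultimately show "r ^ a \<le> p" "p \<le> 2 * r ^ a" by (auto simp: p_def a_def max_def)
  qed
  have ra: "0 < r ^ a" using r_gt_1 by simp
  have p0: "0 < p" using p ra by linarith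
  have "ln (mass mixture (initial_word n) (initial_word n x)) = ln p - ln 2 - real n * ln (1 + r)"
    using p0 r_gt_1 by (simp add: mass_mixture[OF x] p_def[symmetric] ln_div ln_mult ln_realpow)
  moreover have "exponent * log_norm n x = ln (r ^ a)"
    using r_gt_1 by (simp add: exponent_def log_norm_def a_def ln_realpow)
  moreover have "ln (r ^ a) \<le> ln p" using p ra by simp
  moreover have "ln p \<le> ln 2 + ln (r ^ a)"
  proof -
    have "ln p \<le> ln (2 * r ^ a)" using p p0 by simp
    also have "\<dots> = ln 2 + ln (r ^ a)" using ra by (intro ln_mult_pos) auto
    finally show ?thesis .
  qed
  ultimately show "real n * ln (1 + r) - exponent * log_norm n x \<le> - ln (mass mixture (initial_word n) (initial_word n x))"
    "- ln (mass mixture (initial_word n) (initial_word n x))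
        \<le> real n * ln (1 + r) - exponent * log_norm n x + ln 2"
    by linarith+
qed

lemma mass_mixture_pos: "x \<in> space Sigma2 \<Longrightarrow> 0 < mass mixture (initial_word n) (initial_word n x)"
  unfolding mass_mixture using r_gt_1 by (intro divide_pos_pos add_pos_pos) auto

text \<open>
  The Gibbs inequality for words of length \<open>n\<close>, with the masses of the mixture as weights, except that the
  weight inside \<open>E\<close> is multiplied by \<open>1 / e\<close>. Halving all weights keeps the total at most 1, since \<open>E\<close>
  has measure at most \<open>e\<close>; the halving costs \<open>ln 2\<close> and the passage from masses to norms costs another
  \<open>ln 2\<close>. The entropy and the Lyapunov exponent of \<open>\<nu>\<close> enter through their finite-length versions, which bound
  the limits in the right direction by subadditivity. With empty \<open>E\<close> this bounds the pressure; when
  the first summand vanishes it bounds the \<open>\<nu>\<close>-measure of \<open>E\<close> by a multiple of \<open>1 / ln (1 / e)\<close>, for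
  all \<open>n\<close> simultaneously.
\<close>
lemma gibbs_deficit:
  assumes \<nu>: "\<nu> \<in> invariant_measures" and h: "metric_entropy \<nu> left_shift = ereal h"
    and e: "0 < e" "e \<le> 1"
    and small: "measure mixture (initial_word n -` E \<inter> space Sigma2) \<le> e"
  shows "real n * (h + exponent * lyapunov AA \<nu> - ln (1 + r))
      + measure \<nu> (initial_word n -` E \<inter> space Sigma2) * ln (1 / e) \<le> 2 * ln 2"
proof -
  interpret measure_preserving_system \<nu> left_shift by (rule invariant_measures_system[OF \<nu>])
  interpret mix: prob_space mixture by (rule prob_space_mixture)
  have s: "sets \<nu> = sets Sigma2" using \<nu> by (simp add: invariant_measures_def)
  have sp: "space \<nu> = space Sigma2" by (rule sets_eq_imp_space_eq[OF s])
  note W = simple_function_initial_word_Sigma2[OF s, of n]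
  let ?W = "initial_word n ` space Sigma2"
  let ?p = "mass mixture (initial_word n)"
  let ?E = "initial_word n -` E \<inter> space Sigma2"
  define m where "m w = ?p w / 2 * (if w \<in> E then 1 / e else 1)" for w
  have E: "?E \<in> sets Sigma2" by (rule cylinder_in_sets_Sigma2)
  have m_pos: "0 < m w" if "w \<in> ?W" for w
    using that e mass_mixture_pos by (auto simp: m_def)
  have m_le: "(\<Sum>w\<in>?W. m w) \<le> 1"
  proof -
    note W' = simple_function_initial_word_Sigma2[OF sets_mixture, of n]
    have "(\<Sum>w\<in>?W. m w) \<le> (\<Sum>w\<in>?W. indicator E w * ?p w * (1 / (2 * e)) + ?p w * (1 / 2))"
      by (intro sum_mono) (auto simp: m_def indicator_def)
    also have "\<dots> = measure mixture ?E * (1 / (2 * e)) + 1 / 2"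
      using mix.prob_label[OF W', of E] mix.sum_mass[OF W']
      by (simp add: sum.distrib space_mixture sum_distrib_right[symmetric] sum_divide_distrib[symmetric])
    also have "\<dots> \<le> e * (1 / (2 * e)) + 1 / 2"
      using small e by (intro add_right_mono mult_right_mono) auto
    also have "\<dots> = 1" using e by simp
    finally show ?thesis .
  qed
  have log_int: "integrable \<nu> (log_norm n)"
    using integrable_label[OF W, of "\<lambda>w. log_norm n ((!) w)"] by (simp add: log_norm_initial_word[symmetric])
  have E_int: "integrable \<nu> (indicator ?E :: _ \<Rightarrow> real)"
    using E by (simp add: s emeasure_eq_measure)
  obtain h' where h': "metric_entropy \<nu> left_shift = ereal h'" "\<And>n. real n * h' \<le> label_entropy \<nu> (initial_word n)"
    using metric_entropy_left_shift[OF \<nu>] by metis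
  have "real n * h \<le> label_entropy \<nu> (initial_word n)" using h h' by simp
  also have "\<dots> \<le> (LINT x|\<nu>. - ln (m (initial_word n x)))"
    by (rule gibbs_inequality[OF W]) (use m_pos m_le in \<open>auto simp: sp less_imp_le\<close>)
  also have "\<dots> \<le> (LINT x|\<nu>. (real n * ln (1 + r) + 2 * ln 2) - exponent * log_norm n x - ln (1 / e) * indicator ?E x)"
  proof (rule integral_mono)
    show "integrable \<nu> (\<lambda>x. - ln (m (initial_word n x)))"
      using integrable_label[OF W, of "\<lambda>w. - ln (m w)"] .
    show "integrable \<nu> (\<lambda>x. (real n * ln (1 + r) + 2 * ln 2) - exponent * log_norm n x - ln (1 / e) * indicator ?E x)"
      using log_int E_int by (intro Bochner_Integration.integrable_diff integrable_mult_right) auto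
    fix x assume x: "x \<in> space \<nu>"
    then have x': "x \<in> space Sigma2" by (simp add: sp)
    have "ln (m (initial_word n x)) = ln (?p (initial_word n x)) - ln 2 + ln (1 / e) * indicator ?E x"
      using mass_mixture_pos[OF x', of n] e x' by (auto simp: m_def ln_mult ln_div)
    then show "- ln (m (initial_word n x))
        \<le> (real n * ln (1 + r) + 2 * ln 2) - exponent * log_norm n x - ln (1 / e) * indicator ?E x"
      using ln_mass_mixture_le[OF x', of n] by simp
  qed
  also have "\<dots> = (real n * ln (1 + r) + 2 * ln 2) - exponent * (LINT x|\<nu>. log_norm n x) - ln (1 / e) * prob ?E"
    using log_int E_int E by (simp add: prob_space Bochner_Integration.integral_diff s)
  finally have "real n * h + exponent * (LINT x|\<nu>. log_norm n x) + prob ?E * ln (1 / e)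
      \<le> real n * ln (1 + r) + 2 * ln 2"
    by (simp add: algebra_simps)
  moreover have "exponent * (real n * lyapunov AA \<nu>) \<le> exponent * (LINT x|\<nu>. log_norm n x)"
    using r_gt_1 by (intro mult_left_mono lyapunov_le[OF \<nu>]) (simp add: exponent_def)
  ultimately show ?thesis by (simp add: algebra_simps)
qed

text \<open>
  A positive excess would grow linearly in \<open>n\<close>, while \<open>gibbs_deficit\<close> bounds it by \<open>2 ln 2\<close>.
\<close>
lemma pressure_le:
  assumes \<nu>: "\<nu> \<in> invariant_measures" and h: "metric_entropy \<nu> left_shift = ereal h"
  shows "h + exponent * lyapunov AA \<nu> \<le> ln (1 + r)"
proof (rule ccontr)
  assume "\<not> ?thesis"
  then have d: "0 < h + exponent * lyapunov AA \<nu> - ln (1 + r)" by simp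
  obtain n where "2 * ln 2 < real n * (h + exponent * lyapunov AA \<nu> - ln (1 + r))"
    using reals_Archimedean3[OF d] by blast
  then show False
    using gibbs_deficit[OF \<nu> h, of 1 n "{}"] by simp
qed

text \<open>
  For the mixture the information function of words of length \<open>n\<close> is itself bounded below by
  \<open>n ln (1 + r)\<close> minus \<open>s\<close> times the logarithmic norm, so the bound of \<open>pressure_le\<close> is attained.
\<close>
lemma pressure_mixture:
  assumes h: "metric_entropy mixture left_shift = ereal h"
  shows "h + exponent * lyapunov AA mixture = ln (1 + r)"
proof (rule antisym)
  show "h + exponent * lyapunov AA mixture \<le> ln (1 + r)"
    by (rule pressure_le[OF mixture_invariant h])
  interpret prob_space mixture by (rule prob_space_mixture)
  note W = simple_function_initial_word_Sigma2[OF sets_mixture]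
  obtain h' where h': "metric_entropy mixture left_shift = ereal h'"
    "(\<lambda>n. label_entropy mixture (initial_word n) / real n) \<longlonglongrightarrow> h'"
    using metric_entropy_left_shift[OF mixture_invariant] by metis
  have lim_h: "(\<lambda>n. label_entropy mixture (initial_word n) / real n) \<longlonglongrightarrow> h"
    using h h' by simp
  have ge: "ln (1 + r) - exponent * ((LINT x|mixture. log_norm n x) / real n)
      \<le> label_entropy mixture (initial_word n) / real n" if n: "0 < n" for n
  proof -
    have log_int: "integrable mixture (log_norm n)"
      using integrable_label[OF W, of "\<lambda>w. log_norm n ((!) w)" n] by (simp add: log_norm_initial_word[symmetric])
    have "real n * ln (1 + r) - exponent * (LINT x|mixture. log_norm n x)
        = (LINT x|mixture. real n * ln (1 + r) - exponent * log_norm n x)"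
      using log_int by (simp add: prob_space Bochner_Integration.integral_diff)
    also have "\<dots> \<le> label_entropy mixture (initial_word n)"
      unfolding label_entropy_def
    proof (rule integral_mono)
      show "integrable mixture (\<lambda>x. real n * ln (1 + r) - exponent * log_norm n x)"
        using log_int by (intro Bochner_Integration.integrable_diff integrable_mult_right) auto
      show "integrable mixture (\<lambda>x. - ln (mass mixture (initial_word n) (initial_word n x)))"
        using integrable_label[OF W, of "\<lambda>w. - ln (mass mixture (initial_word n) w)" n] .
    qed (simp add: ln_mass_mixture_ge space_mixture)
    finally have "(real n * ln (1 + r) - exponent * (LINT x|mixture. log_norm n x)) / real n
        \<le> label_entropy mixture (initial_word n) / real n"
      by (intro divide_right_mono) auto
    then show ?thesis using n by (simp add: diff_divide_distrib)
  qed
  have "ln (1 + r) - exponent * lyapunov AA mixture \<le> h"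
  proof (rule LIMSEQ_le)
    show "(\<lambda>n. ln (1 + r) - exponent * ((LINT x|mixture. log_norm n x) / real n))
        \<longlonglongrightarrow> ln (1 + r) - exponent * lyapunov AA mixture"
      by (intro tendsto_intros lyapunov_LIMSEQ[OF mixture_invariant])
    show "\<exists>N. \<forall>n\<ge>N. ln (1 + r) - exponent * ((LINT x|mixture. log_norm n x) / real n)
        \<le> label_entropy mixture (initial_word n) / real n"
      using ge by (intro exI[of _ 1]) auto
  qed (rule lim_h)
  then show "ln (1 + r) \<le> h + exponent * lyapunov AA mixture" by simp
qed

end

section \<open>Uniqueness of the equilibrium state\<close>
definition occurs :: "nat list \<Rightarrow> nat \<Rightarrow> (nat \<Rightarrow> nat) \<Rightarrow> real" where
  "occurs w i x = of_bool (\<forall>j<length w. x (i + j) = w ! j)"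

context gibbs_weights
begin

text \<open>
  The probability of seeing \<open>w\<close> at position \<open>i\<close> depends on the parity of \<open>i + \<theta>\<close> only. Over an even
  number of positions both parities occur equally often, so in either phase the mean number of
  occurrences is exactly what the mixture predicts.
\<close>
lemma occurrence_second_moment:
  assumes w: "\<And>j. j < length w \<Longrightarrow> w ! j \<in> {1, 2}"
  shows "(LINT x|alternating \<theta>. ((\<Sum>i<2 * N. occurs w i x) - 2 * real N * mass mixture (initial_word (length w)) w)\<^sup>2)
    \<le> 4 * real (length w) * real N"
proof -
  let ?l = "length w"
  define J where "J i = {i..<i + ?l}" for i
  define v where "v i t = (if t \<in> J i then w ! (t - i) else 1)" for i t
  have v: "v i t \<in> {1, 2}" for i t
    using w[of "t - i"] by (auto simp: v_def J_def)
  define c where "c \<eta> = (\<Prod>j<?l. weight \<eta> j (w ! j))" for \<eta>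
  have cyl: "cylinder (J i) (v i) = {x\<in>space Sigma2. \<forall>j<?l. x (i + j) = w ! j}" for i
  proof -
    have "J i = (+) i ` {..<?l}" by (simp add: J_def lessThan_atLeast0 add.commute)
    then show ?thesis by (auto simp: cylinder_def v_def)
  qed
  have prob: "measure (alternating \<eta>) (cylinder (J i) (v i)) = c (i + \<eta>)" for i \<eta>
  proof -
    have "measure (alternating \<eta>) (cylinder (J i) (v i)) = (\<Prod>t\<in>J i. weight \<eta> t (v i t))"
      using v by (intro measure_alternating_cylinder) (auto simp: J_def)
    also have "\<dots> = (\<Prod>t\<in>J i. weight \<eta> t (w ! (t - i)))"
      by (intro prod.cong) (auto simp: v_def)
    also have "\<dots> = (\<Prod>j<?l. weight \<eta> (i + j) (w ! j))"
      by (rule prod.reindex_bij_witness[where i="\<lambda>j. i + j" and j="\<lambda>t. t - i"]) (auto simp: J_def)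
    also have "\<dots> = c (i + \<eta>)"
      by (simp add: c_def weight_def add.assoc add.commute add.left_commute)
    finally show ?thesis .
  qed
  have c_period: "c (Suc (Suc \<eta>)) = c \<eta>" for \<eta>
    by (simp add: c_def weight_period)
  have sum_c: "(\<Sum>i<2 * N. c (i + \<theta>)) = real N * (c 0 + c (Suc 0))"
  proof (induction N)
    case (Suc N)
    have even: "c (2 * n + \<eta>) = c \<eta>" for n \<eta>
      by (induction n) (simp_all add: c_period)
    have "c \<theta> + c (Suc \<theta>) = c 0 + c (Suc 0)"
      by (induction \<theta>) (simp_all add: c_period)
    then show ?case
      using Suc even[of N \<theta>] even[of N "Suc \<theta>"] by (simp add: algebra_simps)
  qed simp
  have mass: "mass mixture (initial_word ?l) w = (c 0 + c (Suc 0)) / 2"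
  proof -
    have "initial_word ?l -` {w} \<inter> space Sigma2 = cylinder (J 0) (v 0)"
      unfolding cyl by (auto simp: list_eq_iff_nth_eq)
    then show ?thesis
      using prob[of _ 0] sets_cylinder[of "J 0" "v 0"]
      by (simp add: mass_def space_mixture measure_mixture J_def)
  qed
  have "(LINT x|alternating \<theta>. ((\<Sum>i<2 * N. occurs w i x) - 2 * real N * mass mixture (initial_word ?l) w)\<^sup>2)
      = (LINT x|alternating \<theta>. (\<Sum>i<2 * N. indicator (cylinder (J i) (v i)) x
          - measure (alternating \<theta>) (cylinder (J i) (v i)))\<^sup>2)"
  proof (intro Bochner_Integration.integral_cong refl)
    fix x assume "x \<in> space (alternating \<theta>)"
    then have "indicator (cylinder (J i) (v i)) x = occurs w i x" for i
      by (simp add: cyl space_alternating occurs_def indicator_def)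
    then show "((\<Sum>i<2 * N. occurs w i x) - 2 * real N * mass mixture (initial_word ?l) w)\<^sup>2
        = (\<Sum>i<2 * N. indicator (cylinder (J i) (v i)) x
          - measure (alternating \<theta>) (cylinder (J i) (v i)))\<^sup>2"
      by (simp add: prob sum_subtractf sum_c mass)
  qed
  also have "\<dots> \<le> 2 * real ?l * real (2 * N)"
    by (rule alternating_second_moment[OF _ v]) (auto simp: J_def)
  finally show ?thesis by simp
qed

lemma occurs_initial_word:
  assumes "i < n"
  shows "occurs w i ((!) (initial_word (n + length w) x)) = occurs w i x"
  using assms by (simp add: occurs_def)

text \<open>
  Markov's inequality for the square of the deviation, applied in each of the two phases.
\<close>
lemma occurrence_deviation_mixture:
  assumes w: "\<And>j. j < length w \<Longrightarrow> w ! j \<in> {1, 2}" and \<epsilon>: "0 < \<epsilon>" and N: "0 < N"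
  shows "measure mixture {x\<in>space Sigma2.
      \<epsilon> * (2 * real N) \<le> \<bar>(\<Sum>i<2 * N. occurs w i x) - 2 * real N * mass mixture (initial_word (length w)) w\<bar>}
    \<le> real (length w) / (\<epsilon>\<^sup>2 * real N)"
proof -
  define f where "f x = (\<Sum>i<2 * N. occurs w i x) - 2 * real N * mass mixture (initial_word (length w)) w" for x
  let ?A = "{x\<in>space Sigma2. \<epsilon> * (2 * real N) \<le> \<bar>f x\<bar>}"
  have f_word: "f x = f ((!) (initial_word (2 * N + length w) x))" for x
    by (simp add: f_def occurs_initial_word)
  have meas: "f \<in> borel_measurable M" if "sets M = sets Sigma2" for M
    using borel_measurable_simple_function[OF simple_function_compose1[OF
          simple_function_initial_word_Sigma2[OF that], of "\<lambda>v. f ((!) v)" "2 * N + length w"]]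
    by (simp add: f_word[symmetric])
  have A: "?A \<in> sets Sigma2"
    using meas[OF refl] by simp
  have bound: "measure (alternating \<theta>) ?A \<le> real (length w) / (\<epsilon>\<^sup>2 * real N)" for \<theta>
  proof -
    interpret prob_space "alternating \<theta>" by (rule prob_space_alternating)
    have "integrable (alternating \<theta>) (\<lambda>x. (f x)\<^sup>2)"
      using integrable_label[OF simple_function_initial_word_Sigma2[OF sets_alternating[of \<theta>]],
          of "\<lambda>v. (f ((!) v))\<^sup>2" "2 * N + length w"]
      by (simp add: f_word[symmetric])
    then have "measure (alternating \<theta>) {x\<in>space (alternating \<theta>). (\<epsilon> * (2 * real N))\<^sup>2 \<le> (f x)\<^sup>2}
        \<le> (LINT x|alternating \<theta>. (f x)\<^sup>2) / (\<epsilon> * (2 * real N))\<^sup>2"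
      using \<epsilon> N by (intro integral_Markov_inequality_measure[where A="{}"]) auto
    also have "{x\<in>space (alternating \<theta>). (\<epsilon> * (2 * real N))\<^sup>2 \<le> (f x)\<^sup>2} = ?A"
      using \<epsilon> N by (auto simp: space_alternating abs_le_square_iff[symmetric] abs_mult)
    also have "(LINT x|alternating \<theta>. (f x)\<^sup>2) / (\<epsilon> * (2 * real N))\<^sup>2
        \<le> (4 * real (length w) * real N) / (\<epsilon> * (2 * real N))\<^sup>2"
      unfolding f_def using occurrence_second_moment[OF w] by (intro divide_right_mono) auto
    also have "\<dots> = real (length w) / (\<epsilon>\<^sup>2 * real N)"
      using \<epsilon> N by (simp add: field_simps power2_eq_square)
    finally show ?thesis .
  qed
  show ?thesis
    unfolding f_def[symmetric] measure_mixture[OF A]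
  proof -
    have "(a + b) / 2 \<le> c" if "a \<le> c" "b \<le> c" for a b c :: real using that by simp
    then show "(measure (alternating 0) ?A + measure (alternating (Suc 0)) ?A) / 2
        \<le> real (length w) / (\<epsilon>\<^sup>2 * real N)"
      using bound by blast
  qed
qed

text \<open>
  Under the mixture the frequency of \<open>w\<close> in long words is close to the mass of \<open>w\<close> outside a small set,
  which by \<open>gibbs_deficit\<close> is small for \<open>\<nu>\<close> as well. By invariance the mean frequency under \<open>\<nu>\<close> is the
  \<open>\<nu>\<close>-mass of \<open>w\<close>.
\<close>
lemma equality_case_mass:
  assumes \<nu>: "\<nu> \<in> invariant_measures" and h: "metric_entropy \<nu> left_shift = ereal h"
    and eq: "ln (1 + r) \<le> h + exponent * lyapunov AA \<nu>"
    and w: "\<And>j. j < length w \<Longrightarrow> w ! j \<in> {1, 2}"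
  shows "mass \<nu> (initial_word (length w)) w = mass mixture (initial_word (length w)) w"
proof -
  interpret measure_preserving_system \<nu> left_shift by (rule invariant_measures_system[OF \<nu>])
  interpret mix: prob_space mixture by (rule prob_space_mixture)
  have s: "sets \<nu> = sets Sigma2" using \<nu> by (simp add: invariant_measures_def)
  have sp: "space \<nu> = space Sigma2" by (rule sets_eq_imp_space_eq[OF s])
  let ?l = "length w"
  define p where "p = mass mixture (initial_word ?l) w"
  define q where "q = mass \<nu> (initial_word ?l) w"
  have "\<bar>q - p\<bar> \<le> 0 + \<delta>" if \<delta>: "0 < \<delta>" for \<delta>
  proof -
    define \<epsilon> where "\<epsilon> = \<delta> / 2"
    have \<epsilon>: "0 < \<epsilon>" using \<delta> by (simp add: \<epsilon>_def)
    \<comment> \<open>Chosen such that \<open>gibbs_deficit\<close> gives \<open>\<nu>\<close>-measure at most \<open>\<epsilon>\<close>.\<close>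
    define e where "e = exp (- (2 * ln 2) / \<epsilon>)"
    have e: "0 < e" "e \<le> 1" "ln (1 / e) = 2 * ln 2 / \<epsilon>"
      using \<epsilon> by (auto simp: e_def ln_div)
    obtain N where N: "real ?l / (\<epsilon>\<^sup>2 * e) < real N" using reals_Archimedean2 by blast
    have "0 \<le> real ?l / (\<epsilon>\<^sup>2 * e)" using e by simp
    then have N0: "0 < N" using N by linarith
    define f where "f x = (\<Sum>i<2 * N. occurs w i x) - 2 * real N * p" for x
    have f_word: "f x = f ((!) (initial_word (2 * N + ?l) x))" for x
      by (simp add: f_def occurs_initial_word)
    define E where "E = {v. \<epsilon> * (2 * real N) \<le> \<bar>f ((!) v)\<bar>}"
    let ?E = "initial_word (2 * N + ?l) -` E \<inter> space Sigma2"
    have E_eq: "?E = {x\<in>space Sigma2. \<epsilon> * (2 * real N) \<le> \<bar>f x\<bar>}"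
      by (auto simp: E_def f_word[symmetric])
    have E: "?E \<in> events" unfolding s by (rule cylinder_in_sets_Sigma2)
    have "measure mixture ?E \<le> real ?l / (\<epsilon>\<^sup>2 * real N)"
      unfolding E_eq f_def p_def by (rule occurrence_deviation_mixture[OF w \<epsilon> N0])
    also have "\<dots> \<le> e" using N N0 \<epsilon> e by (simp add: field_simps)
    finally have small: "measure mixture ?E \<le> e" .
    have "prob ?E * (2 * ln 2 / \<epsilon>) \<le> 2 * ln 2"
    proof -
      have "0 \<le> real (2 * N + ?l) * (h + exponent * lyapunov AA \<nu> - ln (1 + r))"
        using eq by (intro mult_nonneg_nonneg) auto
      then show ?thesis
        using gibbs_deficit[OF \<nu> h e(1,2) small] unfolding e(3) by linarith
    qed
    then have probE: "prob ?E \<le> \<epsilon>" using \<epsilon> by (simp add: field_simps)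
    have occ_int: "integrable \<nu> (occurs w i)"  and occ: "(LINT x|\<nu>. occurs w i x) = q" for i
    proof -
      have ind: "occurs w i x = indicator (initial_word ?l -` {w} \<inter> space \<nu>) ((left_shift ^^ i) x)"
        if "x \<in> space \<nu>" for x
        using that measurable_space[OF measurable_funpow that, of i]
        by (auto simp: occurs_def indicator_def funpow_left_shift list_eq_iff_nth_eq add.commute)
      have W: "initial_word ?l -` {w} \<inter> space \<nu> \<in> events"
        unfolding s sp by (rule cylinder_in_sets_Sigma2)
      have "integrable \<nu> (\<lambda>x. indicator (initial_word ?l -` {w} \<inter> space \<nu>) ((left_shift ^^ i) x) :: real)"
        using measurable_compose[OF measurable_funpow borel_measurable_indicator[OF W]]
        by (intro integrable_const_bound[where B=1]) auto
      then show "integrable \<nu> (occurs w i)"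
        using ind by (subst Bochner_Integration.integrable_cong) auto
      have "(LINT x|\<nu>. occurs w i x)
          = (LINT x|\<nu>. indicator (initial_word ?l -` {w} \<inter> space \<nu>) ((left_shift ^^ i) x))"
        using ind by (intro Bochner_Integration.integral_cong) auto
      also have "\<dots> = (LINT x|\<nu>. indicator (initial_word ?l -` {w} \<inter> space \<nu>) x)"
        using W by (intro integral_funpow) simp
      also have "\<dots> = q" using W by (simp add: q_def mass_def)
      finally show "(LINT x|\<nu>. occurs w i x) = q" .
    qed
    have f_int: "integrable \<nu> f" unfolding f_def using occ_int by auto
    have "2 * real N * \<bar>q - p\<bar> = \<bar>LINT x|\<nu>. f x\<bar>"
    proof -
      have "(LINT x|\<nu>. f x) = 2 * real N * (q - p)"
        unfolding f_def using occ_int occ by (simp add: prob_space algebra_simps)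
      then show ?thesis by (simp add: abs_mult)
    qed
    also have "\<dots> \<le> (LINT x|\<nu>. \<bar>f x\<bar>)" by (rule integral_abs_bound)
    also have "\<dots> \<le> (LINT x|\<nu>. 2 * real N * \<epsilon> + 2 * real N * indicator ?E x)"
    proof (rule integral_mono)
      show "integrable \<nu> (\<lambda>x. \<bar>f x\<bar>)" using f_int by simp
      show "integrable \<nu> (\<lambda>x. 2 * real N * \<epsilon> + 2 * real N * indicator ?E x)"
        using E by (intro Bochner_Integration.integrable_add integrable_mult_right) (auto simp: emeasure_eq_measure)
      fix x assume x: "x \<in> space \<nu>"
      show "\<bar>f x\<bar> \<le> 2 * real N * \<epsilon> + 2 * real N * indicator ?E x"
      proof (cases "x \<in> ?E")
        case True
        have "0 \<le> (\<Sum>i<2 * N. occurs w i x)" by (intro sum_nonneg) (simp add: occurs_def)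
        moreover have "(\<Sum>i<2 * N. occurs w i x) \<le> 2 * real N"
          using sum_bounded_above[of "{..<2 * N}" "\<lambda>i. occurs w i x" 1] by (simp add: occurs_def)
        moreover have "0 \<le> 2 * real N * p" "2 * real N * p \<le> 2 * real N"
          by (auto simp: p_def mass_def intro!: mult_left_le)
        ultimately have "\<bar>f x\<bar> \<le> 2 * real N" unfolding f_def by linarith
        moreover have "0 \<le> 2 * real N * \<epsilon>" using \<epsilon> by simp
        ultimately show ?thesis unfolding indicator_simps(1)[OF True] by linarith
      next
        case False
        then have "\<bar>f x\<bar> < \<epsilon> * (2 * real N)"
          using x unfolding E_eq sp by simp
        then show ?thesis
          unfolding indicator_simps(2)[OF False] by (simp add: algebra_simps)
      qed
    qed
    also have "\<dots> = 2 * real N * (\<epsilon> + prob ?E)"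
      using E by (subst Bochner_Integration.integral_add) (auto simp: prob_space emeasure_eq_measure algebra_simps)
    also have "\<dots> \<le> 2 * real N * \<delta>"
      using probE by (intro mult_left_mono) (auto simp: \<epsilon>_def)
    finally show ?thesis using N0 by simp
  qed
  then have "\<bar>q - p\<bar> \<le> 0" by (rule field_le_epsilon)
  then show ?thesis by (simp add: p_def q_def)
qed

theorem equality_case:
  assumes \<nu>: "\<nu> \<in> invariant_measures" and h: "metric_entropy \<nu> left_shift = ereal h"
    and eq: "ln (1 + r) \<le> h + exponent * lyapunov AA \<nu>"
  shows "\<nu> = mixture"
proof (rule Sigma2_measure_eqI)
  show "prob_space \<nu>" "sets \<nu> = sets Sigma2" using \<nu> by (auto simp: invariant_measures_def)
  then have sp: "space \<nu> = space Sigma2" using sets_eq_imp_space_eq by blast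
  fix n and w :: "nat list"
  show "mass \<nu> (initial_word n) w = mass mixture (initial_word n) w"
  proof (cases "w \<in> initial_word n ` space Sigma2")
    case True
    then have "n = length w" "\<And>j. j < length w \<Longrightarrow> w ! j \<in> {1, 2}"
      by (auto simp: space_Sigma2)
    then show ?thesis using equality_case_mass[OF \<nu> h eq] by simp
  next
    case False
    then show ?thesis by (simp add: mass_initial_word_notin sp space_mixture)
  qed
qed (simp_all add: prob_space_mixture sets_mixture)

section \<open>Failure of ergodicity and mixing\<close>
text \<open>
  The second moment of the deviation of the frequency at time \<open>n\<close> is at most \<open>2 / n\<close>. Along the squares
  these bounds are summable, so the squared deviations have an almost surely finite sum and tend
  to zero. Almost sure convergence along the squares suffices to separate the two phases.
\<close>
lemma gain_frequency_AE:
  "AE x in alternating \<theta>. (\<lambda>k. real (gain x (k\<^sup>2)) / real (k\<^sup>2)) \<longlonglongrightarrow> weight \<theta> 0 2"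
proof -
  interpret prob_space "alternating \<theta>" by (rule prob_space_alternating)
  define q where "q = weight \<theta> 0 2"
  define v :: "nat \<Rightarrow> nat \<Rightarrow> nat" where "v i t = (if even i then 2 else 1)" for i t
  have prob: "prob (cylinder {i} (v i)) = q" for i
    by (subst measure_alternating_cylinder) (auto simp: v_def q_def weight_def)
  define S where "S n x = real (gain x n) - real n * q" for n x
  have S_eq: "S n x = (\<Sum>i<n. indicator (cylinder {i} (v i)) x - prob (cylinder {i} (v i)))"
    if "x \<in> space (alternating \<theta>)" for n x
  proof -
    have "indicator (cylinder {i} (v i)) x = (of_bool ((x i \<noteq> 1) = even i) :: real)" for i
    proof -
      have "x i \<in> {1, 2}" using that by (simp add: space_alternating space_Sigma2)
      then show ?thesis
        using that by (auto simp: cylinder_def v_def space_alternating indicator_def)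
    qed
    then show ?thesis by (simp add: prob S_def gain_def sum_subtractf)
  qed
  have S_word: "S n x = S n ((!) (initial_word n x))" for n x
    using gain_initial_word[of x n] by (simp add: S_def)
  note W = simple_function_initial_word_Sigma2[OF sets_alternating[of \<theta>]]
  have S_int: "integrable (alternating \<theta>) (\<lambda>x. g (S n x))" for n and g :: "real \<Rightarrow> real"
    using integrable_label[OF W, of "\<lambda>w. g (S n ((!) w))" n] by (simp add: S_word[symmetric])
  have moment: "(LINT x|alternating \<theta>. (S n x)\<^sup>2) \<le> 2 * real n" for n
  proof -
    have "(LINT x|alternating \<theta>. (S n x)\<^sup>2)
        = (LINT x|alternating \<theta>. (\<Sum>i<n. indicator (cylinder {i} (v i)) x - prob (cylinder {i} (v i)))\<^sup>2)"
      by (intro Bochner_Integration.integral_cong) (simp_all add: S_eq)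
    also have "\<dots> \<le> 2 * real 1 * real n"
      by (rule alternating_second_moment) (auto simp: v_def)
    finally show ?thesis by simp
  qed
  \<comment> \<open>For \<open>k = 0\<close> this is \<open>0 / 0 = 0\<close>, so the bounds below hold for that index as well.\<close>
  let ?g = "\<lambda>k x. (S (k\<^sup>2) x / real (k\<^sup>2))\<^sup>2"
  have "(\<integral>\<^sup>+x. (\<Sum>k. ennreal (?g k x)) \<partial>alternating \<theta>) = (\<Sum>k. \<integral>\<^sup>+x. ennreal (?g k x) \<partial>alternating \<theta>)"
    using S_int[of "\<lambda>t. (t / real (_\<^sup>2))\<^sup>2"] by (intro nn_integral_suminf) auto
  also have "\<dots> \<le> (\<Sum>k. ennreal (2 * inverse (real k ^ 2)))"
  proof (intro suminf_le allI)
    fix k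
    have "(\<integral>\<^sup>+x. ennreal (?g k x) \<partial>alternating \<theta>) = ennreal (LINT x|alternating \<theta>. ?g k x)"
      using S_int[of "\<lambda>t. (t / real (k\<^sup>2))\<^sup>2"] by (intro nn_integral_eq_integral) auto
    also have "(LINT x|alternating \<theta>. ?g k x) = (LINT x|alternating \<theta>. (S (k\<^sup>2) x)\<^sup>2) / (real (k\<^sup>2))\<^sup>2"
      by (simp add: power_divide)
    also have "\<dots> \<le> 2 * real (k\<^sup>2) / (real (k\<^sup>2))\<^sup>2"
      by (intro divide_right_mono moment) simp
    also have "\<dots> = 2 * inverse (real k ^ 2)"
      by (simp add: power2_eq_square field_simps)
    finally show "(\<integral>\<^sup>+x. ennreal (?g k x) \<partial>alternating \<theta>) \<le> ennreal (2 * inverse (real k ^ 2))"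
      by (simp add: ennreal_leI)
  qed auto
  also have "\<dots> = ennreal (\<Sum>k. 2 * inverse (real k ^ 2))"
    by (intro suminf_ennreal2 summable_mult inverse_power_summable) auto
  also have "\<dots> < \<infinity>" by simp
  finally have "(\<integral>\<^sup>+x. (\<Sum>k. ennreal (?g k x)) \<partial>alternating \<theta>) \<noteq> \<infinity>" by simp
  then have "AE x in alternating \<theta>. (\<Sum>k. ennreal (?g k x)) \<noteq> \<infinity>"
    using S_int[of "\<lambda>t. (t / real (_\<^sup>2))\<^sup>2"] by (intro nn_integral_PInf_AE) auto
  then show ?thesis
  proof (eventually_elim)
    case (elim x)
    have "summable (\<lambda>k. ?g k x)"
      using elim by (intro summable_suminf_not_top) auto
    then have "(\<lambda>k. ?g k x) \<longlonglongrightarrow> 0" by (rule summable_LIMSEQ_zero)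
    then have "(\<lambda>k. sqrt (?g k x)) \<longlonglongrightarrow> sqrt 0" by (rule tendsto_real_sqrt)
    then have "(\<lambda>k. \<bar>S (k\<^sup>2) x / real (k\<^sup>2)\<bar>) \<longlonglongrightarrow> 0"
      by (simp only: real_sqrt_abs real_sqrt_zero)
    then have "(\<lambda>k. S (k\<^sup>2) x / real (k\<^sup>2)) \<longlonglongrightarrow> 0"
      by (rule tendsto_rabs_zero_cancel)
    then have "(\<lambda>k. S (k\<^sup>2) x / real (k\<^sup>2) + q) \<longlonglongrightarrow> 0 + q"
      by (intro tendsto_intros)
    moreover have "\<forall>\<^sub>F k in sequentially. S (k\<^sup>2) x / real (k\<^sup>2) + q = real (gain x (k\<^sup>2)) / real (k\<^sup>2)"
      using eventually_gt_at_top[of 0] by eventually_elim (simp add: S_def diff_divide_distrib)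
    ultimately have "(\<lambda>k. real (gain x (k\<^sup>2)) / real (k\<^sup>2)) \<longlonglongrightarrow> 0 + q"
      by (rule Lim_transform_eventually)
    then show ?case by (simp add: q_def)
  qed
qed

text \<open>
  The points with the frequency of stretching steps that is typical for phase 0.
\<close>
definition high_gain_set :: "(nat \<Rightarrow> nat) set" where
  "high_gain_set = {x\<in>space Sigma2. (\<lambda>k. real (gain x (k\<^sup>2)) / real (k\<^sup>2)) \<longlonglongrightarrow> weight 0 0 2}"

lemma sets_high_gain_set: "high_gain_set \<in> sets Sigma2"
proof -
  have "(\<lambda>x. real (gain x n)) \<in> borel_measurable Sigma2" for n
    using borel_measurable_simple_function[OF simple_function_compose1[OF
          simple_function_initial_word_Sigma2[OF refl], of "\<lambda>w. real (gain ((!) w) n)" n]]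
    by (simp add: gain_initial_word[symmetric])
  then have "Measurable.pred Sigma2 (\<lambda>x. (\<lambda>k. real (gain x (k\<^sup>2)) / real (k\<^sup>2)) \<longlonglongrightarrow> weight 0 0 2)"
    by (intro measurable_limit2) auto
  then show ?thesis unfolding high_gain_set_def by (rule predE)
qed

lemma measure_high_gain_set: "measure mixture high_gain_set = 1 / 2"
proof -
  interpret A0: prob_space "alternating 0" by (rule prob_space_alternating)
  interpret A1: prob_space "alternating (Suc 0)" by (rule prob_space_alternating)
  have "AE x in alternating 0. x \<in> high_gain_set"
    using gain_frequency_AE[of 0] AE_space
    by eventually_elim (simp add: high_gain_set_def space_alternating)
  then have "measure (alternating 0) high_gain_set = 1"
    using sets_high_gain_set by (subst A0.prob_eq_1) (simp_all add: sets_alternating)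
  moreover have "AE x in alternating (Suc 0). x \<notin> high_gain_set"
    using gain_frequency_AE[of "Suc 0"]
  proof eventually_elim
    case (elim x)
    have "weight 0 0 2 \<noteq> weight (Suc 0) 0 2" using r_gt_1 by (simp add: weight_def)
    then show ?case using elim LIMSEQ_unique unfolding high_gain_set_def by blast
  qed
  then have "measure (alternating (Suc 0)) high_gain_set = 0"
    using sets_high_gain_set by (subst A1.prob_eq_0) (simp_all add: sets_alternating)
  ultimately show ?thesis
    using measure_mixture[OF sets_high_gain_set] by simp
qed

text \<open>
  Two steps preserve parity, so they change the number of stretching steps by at most 2.
\<close>
lemma high_gain_set_invariant: "(left_shift ^^ 2) -` high_gain_set \<inter> space Sigma2 = high_gain_set"
proof -
  have "(left_shift ^^ 2) x \<in> high_gain_set \<longleftrightarrow> x \<in> high_gain_set" if x: "x \<in> space Sigma2" for x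
  proof -
    let ?y = "(left_shift ^^ 2) x"
    have y: "?y \<in> space Sigma2" using x by (simp add: space_Sigma2 funpow_left_shift)
    have bound: "\<bar>real (gain ?y n) - real (gain x n)\<bar> \<le> 2" for n
    proof -
      have "gain x (2 + n) = gain x 2 + gain ?y n" by (subst gain_add) simp
      moreover have "gain x 2 \<le> 2" by (rule gain_le)
      moreover have "gain x n \<le> gain x (2 + n)" "gain x (2 + n) \<le> gain x n + 2"
        by (simp_all add: gain_Suc)
      ultimately show ?thesis by linarith
    qed
    have "(\<lambda>k. real (gain ?y (k\<^sup>2)) / real (k\<^sup>2) - real (gain x (k\<^sup>2)) / real (k\<^sup>2)) \<longlonglongrightarrow> 0"
    proof (rule Lim_null_comparison)
      show "\<forall>\<^sub>F k in sequentially. norm (real (gain ?y (k\<^sup>2)) / real (k\<^sup>2) - real (gain x (k\<^sup>2)) / real (k\<^sup>2))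
          \<le> 2 * inverse (real k ^ 2)"
      proof (intro always_eventually allI)
        fix k
        have "norm (real (gain ?y (k\<^sup>2)) / real (k\<^sup>2) - real (gain x (k\<^sup>2)) / real (k\<^sup>2))
            = \<bar>real (gain ?y (k\<^sup>2)) - real (gain x (k\<^sup>2))\<bar> / real (k\<^sup>2)"
          unfolding diff_divide_distrib[symmetric] real_norm_def abs_divide by simp
        also have "\<dots> \<le> 2 / real (k\<^sup>2)" by (intro divide_right_mono bound) simp
        finally show "norm (real (gain ?y (k\<^sup>2)) / real (k\<^sup>2) - real (gain x (k\<^sup>2)) / real (k\<^sup>2))
            \<le> 2 * inverse (real k ^ 2)"
          by (simp add: divide_inverse)
      qed
      have "(\<lambda>k. 2 * inverse (real k ^ 2)) \<longlonglongrightarrow> 0"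
        by (intro summable_LIMSEQ_zero summable_mult inverse_power_summable) simp
      then show "(\<lambda>k. 2 * inverse (real k ^ 2)) \<longlonglongrightarrow> 0" .
    qed
    from Lim_transform_eq[OF this] show ?thesis
      using x y by (simp add: high_gain_set_def)
  qed
  then show ?thesis by (auto simp: high_gain_set_def)
qed

lemma mixture_not_ergodic: "\<not> is_ergodic mixture (left_shift ^^ 2)"
proof
  assume "is_ergodic mixture (left_shift ^^ 2)"
  then have "measure mixture high_gain_set = 0 \<or> measure mixture high_gain_set = 1"
    using sets_high_gain_set high_gain_set_invariant
    unfolding is_ergodic_def sets_mixture space_mixture by blast
  then show False by (simp add: measure_high_gain_set)
qed

lemma equilibrium_state_iff: "equilibrium_state AA exponent \<mu> \<longleftrightarrow> \<mu> = mixture"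
proof -
  let ?F = "\<lambda>\<nu>. metric_entropy \<nu> left_shift + ereal (exponent * lyapunov AA \<nu>)"
  have le: "?F \<nu> \<le> ereal (ln (1 + r))" if \<nu>: "\<nu> \<in> invariant_measures" for \<nu>
  proof -
    obtain h where "metric_entropy \<nu> left_shift = ereal h"
      using metric_entropy_left_shift[OF \<nu>] by metis
    then show ?thesis using pressure_le[OF \<nu>] by simp
  qed
  have mix: "?F mixture = ereal (ln (1 + r))"
  proof -
    obtain h where "metric_entropy mixture left_shift = ereal h"
      using metric_entropy_left_shift[OF mixture_invariant] by metis
    then show ?thesis using pressure_mixture by simp
  qed
  have sup: "(SUP \<nu>\<in>invariant_measures. ?F \<nu>) = ereal (ln (1 + r))"
  proof (rule antisym)
    show "(SUP \<nu>\<in>invariant_measures. ?F \<nu>) \<le> ereal (ln (1 + r))"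
      using le by (rule SUP_least)
    show "ereal (ln (1 + r)) \<le> (SUP \<nu>\<in>invariant_measures. ?F \<nu>)"
      unfolding mix[symmetric] by (rule SUP_upper[OF mixture_invariant])
  qed
  show ?thesis
  proof
    assume "\<mu> = mixture"
    then show "equilibrium_state AA exponent \<mu>"
      unfolding equilibrium_state_def sup by (simp add: mixture_invariant mix)
  next
    assume "equilibrium_state AA exponent \<mu>"
    then have \<mu>: "\<mu> \<in> invariant_measures" and F: "?F \<mu> = ereal (ln (1 + r))"
      unfolding equilibrium_state_def sup by auto
    obtain h where h: "metric_entropy \<mu> left_shift = ereal h"
      using metric_entropy_left_shift[OF \<mu>] by metis
    show "\<mu> = mixture"
      by (rule equality_case[OF \<mu> h]) (use F h in simp)
  qed
qed

end

text \<open>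
  A set invariant under \<open>T\<^sup>k\<close> equals its preimages under all \<open>T\<^sup>k\<^sup>n\<close>. Mixing along this subsequence makes
  the set independent of itself.
\<close>
lemma mixing_imp_ergodic_funpow:
  assumes "prob_space M" and T: "T \<in> space M \<rightarrow> space M" and mix: "is_mixing M T" and k: "0 < k"
  shows "is_ergodic M (T ^^ k)"
  unfolding is_ergodic_def
proof (intro ballI impI)
  fix B assume B: "B \<in> sets M" and inv: "(T ^^ k) -` B \<inter> space M = B"
  have sub: "B \<subseteq> space M" using B by (rule sets.sets_into_space)
  have Tk: "(T ^^ n) x \<in> space M" if "x \<in> space M" for n x
    using that T by (induction n) auto
  have iter: "(T ^^ (k * n)) -` B \<inter> space M = B" for n
  proof (induction n)
    case (Suc n)
    have "(T ^^ (k * Suc n)) -` B \<inter> space M = (T ^^ (k * n)) -` ((T ^^ k) -` B \<inter> space M) \<inter> space M"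
      using Tk by (auto simp: funpow_add)
    then show ?case using inv Suc by simp
  qed (use sub in auto)
  have "(\<lambda>n. measure M (B \<inter> ((T ^^ n) -` B \<inter> space M))) \<longlonglongrightarrow> measure M B * measure M B"
    using mix B by (simp add: is_mixing_def)
  moreover have "strict_mono (\<lambda>n. k * n)" using k by (simp add: strict_mono_def)
  ultimately have "(\<lambda>n. measure M (B \<inter> ((T ^^ (k * n)) -` B \<inter> space M))) \<longlonglongrightarrow> measure M B * measure M B"
    using LIMSEQ_subseq_LIMSEQ[of _ _ "\<lambda>n. k * n"] by (simp add: comp_def)
  then have "(\<lambda>n::nat. measure M B) \<longlonglongrightarrow> measure M B * measure M B"
    by (simp add: iter)
  then have "measure M B = measure M B * measure M B"
    by (simp add: LIMSEQ_const_iff)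
  then show "measure M B = 0 \<or> measure M B = 1" by simp
qed

theorem proposition6:
  fixes s :: real
  assumes "s > 0"
  shows "(\<exists>!\<mu>. equilibrium_state AA s \<mu>) \<and>
         (\<forall>\<mu>. equilibrium_state AA s \<mu> \<longrightarrow>
               \<not> is_ergodic \<mu> (left_shift ^^ 2) \<and> \<not> is_mixing \<mu> left_shift)"
proof -
  interpret gibbs_weights "2 powr s"
    by unfold_locales (use assms in simp)
  have s: "exponent = s" by (simp add: exponent_def ln_powr)
  have unique: "equilibrium_state AA s \<mu> \<longleftrightarrow> \<mu> = mixture" for \<mu>
    using equilibrium_state_iff unfolding s .
  have "left_shift \<in> space mixture \<rightarrow> space mixture"
    by (auto simp: space_mixture space_Sigma2 left_shift_def)
  then have "\<not> is_mixing mixture left_shift"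
    using mixing_imp_ergodic_funpow[OF prob_space_mixture, of left_shift 2] mixture_not_ergodic by auto
  then show ?thesis
    using mixture_not_ergodic by (simp add: unique)
qed

end
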